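(* Let $M$ be a flat affine two-torus. Then the development map $D:\tilde M\to\mathbb{A}^2$ of $M$ is a covering map onto its image.
   Context: A flat affine two-torus is a manifold $M$ diffeomorphic to $T^2$ with a maximal atlas of charts in $\mathbb{A}^2=\mathbb{R}^2$ whose coordinate changes are locally restrictions of elements of the affine group $\mathrm{Aff}(2)$. Its universal covering $\tilde M$ inherits a flat affine structure, and the development map $D:\tilde M\to\mathbb{A}^2$ is the local diffeomorphism, affine in the charts, obtained by analytic continuation of a local affine chart; it is unique up to composition with an element of $\mathrm{Aff}(2)$. *)

theory Defs
  imports "HOL-Analysis.Analysis"
begin

text \<open>
  A surface is a set \<open>X\<close> with its subspace topology. A chart is a pair \<open>(U, \<phi>)\<close>; only the values of
  \<open>\<phi>\<close> on \<open>U\<close> matter, so a maximal atlas contains with \<open>(U, \<phi>)\<close> every pair \<open>(U, \<phi>')\<close> such that \<open>\<phi>'\<close>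
  agrees with \<open>\<phi>\<close> on \<open>U\<close>. The affine plane is \<open>real ^ 2\<close>.
\<close>

type_synonym 'a chart = "'a set \<times> ('a \<Rightarrow> real ^ 2)"

definition is_chart :: "'a::topological_space set \<Rightarrow> 'a chart \<Rightarrow> bool" where
  "is_chart X = (\<lambda>(U, \<phi>). openin (top_of_set X) U \<and> open (\<phi> ` U) \<and>
                 (\<exists>\<psi>. homeomorphism U (\<phi> ` U) \<phi> \<psi>))"

definition Aff2 :: "(real ^ 2 \<Rightarrow> real ^ 2) set" where
  "Aff2 = {g. \<exists>(L :: real ^ 2 ^ 2) b. invertible L \<and> g = (\<lambda>x. L *v x + b)}"

text \<open>\<open>f\<close> equals \<open>g \<circ> h\<close> near every point of \<open>W\<close>, where \<open>g\<close> in \<open>Aff2\<close> may depend on the point.\<close>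

definition locally_affinely_related ::
    "'a::topological_space set \<Rightarrow> 'a set \<Rightarrow> ('a \<Rightarrow> real ^ 2) \<Rightarrow> ('a \<Rightarrow> real ^ 2) \<Rightarrow> bool" where
  "locally_affinely_related X W f h \<longleftrightarrow>
     (\<forall>x\<in>W. \<exists>g\<in>Aff2. \<exists>N. openin (top_of_set X) N \<and> x \<in> N \<and> N \<subseteq> W \<and> (\<forall>y\<in>N. f y = g (h y)))"

text \<open>For charts this says that the coordinate change from \<open>\<phi>\<close> to \<open>\<psi>\<close> is locally the restriction of
  an element of \<open>Aff2\<close>.\<close>

definition affinely_compatible ::
    "'a::topological_space set \<Rightarrow> 'a chart \<Rightarrow> 'a chart \<Rightarrow> bool" where
  "affinely_compatible X = (\<lambda>(U, \<phi>) (V, \<psi>). locally_affinely_related X (U \<inter> V) \<psi> \<phi>)"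

definition flat_affine_structure :: "'a::topological_space set \<Rightarrow> 'a chart set \<Rightarrow> bool" where
  "flat_affine_structure X \<A> \<longleftrightarrow>
     (\<forall>c\<in>\<A>. is_chart X c) \<and>
     (\<Union>c\<in>\<A>. fst c) = X \<and>
     (\<forall>c\<in>\<A>. \<forall>d\<in>\<A>. affinely_compatible X c d) \<and>
     (\<forall>d. is_chart X d \<and> (\<forall>c\<in>\<A>. affinely_compatible X c d \<and> affinely_compatible X d c) \<longrightarrow> d \<in> \<A>)"

text \<open>\<open>Ck_on k f S\<close> is meant for open \<open>S\<close>, where it says that \<open>f\<close> is of class \<open>C\<^sup>k\<close> on \<open>S\<close>.\<close>

primrec Ck_on ::
    "nat \<Rightarrow> ('a::euclidean_space \<Rightarrow> 'b::real_normed_vector) \<Rightarrow> 'a set \<Rightarrow> bool" where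
  "Ck_on 0 f S \<longleftrightarrow> continuous_on S f"
| "Ck_on (Suc k) f S \<longleftrightarrow>
     (\<forall>x\<in>S. f differentiable (at x)) \<and> (\<forall>v. Ck_on k (\<lambda>x. frechet_derivative f (at x) v) S)"

definition smooth_on ::
    "'a::euclidean_space set \<Rightarrow> ('a \<Rightarrow> 'b::real_normed_vector) \<Rightarrow> bool" where
  "smooth_on S f \<longleftrightarrow> (\<forall>k. Ck_on k f S)"

definition smooth_map ::
    "'a chart set \<Rightarrow> 'b chart set \<Rightarrow> ('a \<Rightarrow> 'b) \<Rightarrow> bool" where
  "smooth_map \<A> \<B> f \<longleftrightarrow>
     (\<forall>(U, \<phi>)\<in>\<A>. \<forall>(V, \<psi>)\<in>\<B>. smooth_on (\<phi> ` (U \<inter> f -` V)) (\<psi> \<circ> f \<circ> inv_into U \<phi>))"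

definition diffeomorphic ::
    "'a::topological_space set \<Rightarrow> 'a chart set \<Rightarrow> 'b::topological_space set \<Rightarrow> 'b chart set \<Rightarrow> bool" where
  "diffeomorphic X \<A> Y \<B> \<longleftrightarrow>
     (\<exists>f h. homeomorphism X Y f h \<and> smooth_map \<A> \<B> f \<and> smooth_map \<B> \<A> h)"

definition torus :: "(complex \<times> complex) set" where
  "torus = sphere 0 1 \<times> sphere 0 1"

text \<open>The charts of the torus are the local inverses of \<open>(s, t) \<mapsto> (exp (\<i>s), exp (\<i>t))\<close>.\<close>

definition torus_atlas :: "(complex \<times> complex) chart set" where
  "torus_atlas = {(V, \<theta>). is_chart torus (V, \<theta>) \<and> (\<forall>z\<in>V. (cis (\<theta> z $ 1), cis (\<theta> z $ 2)) = z)}"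

text \<open>Affine coordinate changes are smooth, so \<open>\<A>\<close> also defines the smooth structure of \<open>M\<close>. That \<open>M\<close>
  is Hausdorff and second countable follows from the homeomorphism with the torus.\<close>

definition flat_affine_two_torus :: "'a::topological_space set \<Rightarrow> 'a chart set \<Rightarrow> bool" where
  "flat_affine_two_torus M \<A> \<longleftrightarrow>
     flat_affine_structure M \<A> \<and> diffeomorphic M \<A> torus torus_atlas"

definition universal_covering ::
    "'b::topological_space set \<Rightarrow> ('b \<Rightarrow> 'a) \<Rightarrow> 'a::topological_space set \<Rightarrow> bool" where
  "universal_covering Mt p M \<longleftrightarrow> covering_space Mt p M \<and> simply_connected Mt"

text \<open>The maximal atlas on the covering space for which \<open>p\<close> is locally an affine isomorphism.\<close>

definition inherited_structure ::
    "'b::topological_space set \<Rightarrow> ('b \<Rightarrow> 'a) \<Rightarrow> 'a::topological_space chart set \<Rightarrow> 'b chart set" where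
  "inherited_structure Mt p \<A> =
     {(W, \<psi>). is_chart Mt (W, \<psi>) \<and>
        (\<forall>(U, \<phi>)\<in>\<A>. locally_affinely_related Mt (W \<inter> p -` U) \<psi> (\<phi> \<circ> p))}"

text \<open>The first conjunct says that \<open>D\<close> is a local diffeomorphism that is affine in the charts. The
  second says that \<open>D\<close> extends a chart \<open>(U, \<phi>)\<close>; as the covering is connected, \<open>D\<close> is then the
  analytic continuation of \<open>\<phi>\<close>.\<close>

definition development_map ::
    "'b::topological_space set \<Rightarrow> 'b chart set \<Rightarrow> ('b \<Rightarrow> real ^ 2) \<Rightarrow> bool" where
  "development_map Mt \<A> D \<longleftrightarrow>
     (\<forall>(U, \<phi>)\<in>\<A>. locally_affinely_related Mt U D \<phi>) \<and>
     (\<exists>(U, \<phi>)\<in>\<A>. U \<noteq> {} \<and> (\<forall>x\<in>U. D x = \<phi> x))"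

end

theory Submission
  imports Defs
begin

text \<open>
  The universal covering is the plane, and the development map becomes an immersion \<open>f\<close> of the plane that
  is equivariant under the lattice of periods, acting on the target through commuting affine maps. A flow
  on the target that commutes with this holonomy lifts to a complete flow on the source, because the
  torus is compact. Two generators of the holonomy either have linear parts with a common fixed
  vector or have a common fixed point.

  In the first case translations along the vector lift, so \<open>f\<close> is complete in one direction, and this
  makes it injective. In the second case let the fixed point be \<open>0\<close>; the dilations lift. If \<open>f\<close> has a zero,
  their expansion spreads a local inverse over the whole plane. Otherwise \<open>f = exp \<circ> F\<close>, where \<open>F\<close> is
  complete in the real direction, hence injective with image a strip \<open>\<real> \<times> I\<close>. If \<open>I\<close> is the whole line, then \<open>f\<close>
  is a covering of the punctured plane. If \<open>I\<close> has an endpoint and is longer than \<open>\<pi>\<close>, the ray opposite to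
  the endpoint yields a line in the plane on which a subgroup of finite index of the deck group acts by
  translations, which is impossible for a group of rank two. So the length of \<open>I\<close> is at most \<open>\<pi>\<close> and \<open>f\<close>
  is injective.
\<close>

section \<open>Lifting along unramified maps\<close>

lemma continuous_on_openin_cover:
  assumes "\<And>x. x \<in> S \<Longrightarrow> \<exists>N. openin (top_of_set S) N \<and> x \<in> N \<and> continuous_on N f"
  shows "continuous_on S f"
  unfolding continuous_on_def
proof (rule ballI)
  fix x assume "x \<in> S"
  then obtain N where N: "openin (top_of_set S) N" "x \<in> N" "continuous_on N f"
    using assms by blast
  then obtain O' where "open O'" "N = S \<inter> O'" by (auto simp: openin_open)
  then show "(f \<longlongrightarrow> f x) (at x within S)"
    using N at_within_nhd[of x O' S "S \<inter> O'"] by (auto simp: continuous_on_def)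
qed

locale unramified =
  fixes X :: "'b::topological_space set" and F :: "'b \<Rightarrow> 'c::topological_space"
  assumes separated: "\<And>x y. \<lbrakk>x \<in> X; y \<in> X; x \<noteq> y\<rbrakk> \<Longrightarrow>
      \<exists>U V. openin (top_of_set X) U \<and> openin (top_of_set X) V \<and> x \<in> U \<and> y \<in> V \<and> U \<inter> V = {}"
    and locally_inj: "\<And>x. x \<in> X \<Longrightarrow> \<exists>N. openin (top_of_set X) N \<and> x \<in> N \<and> inj_on F N"
    and continuous: "continuous_on X F"
begin

lemma lift_unique:
  assumes "connected T" "continuous_on T c" "c \<in> T \<rightarrow> X" "continuous_on T d" "d \<in> T \<rightarrow> X"
    and eq: "\<And>t. t \<in> T \<Longrightarrow> F (c t) = F (d t)" and a: "a \<in> T" "c a = d a" and "t \<in> T"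
  shows "c t = d t"
proof -
  let ?A = "{t \<in> T. c t = d t}"
  have 1: "openin (top_of_set T) ?A"
  proof (subst openin_subopen, clarify)
    fix s assume s: "s \<in> T" "c s = d s"
    then have "c s \<in> X" using assms(3) s(1) by blast
    then obtain N where N: "openin (top_of_set X) N" "c s \<in> N" "inj_on F N"
      using locally_inj by blast
    let ?S = "(T \<inter> c -` N) \<inter> (T \<inter> d -` N)"
    have "openin (top_of_set T) ?S"
      using N(1) assms(2-5) by (intro openin_Int continuous_openin_preimage)
    moreover have "s \<in> ?S" using s N by auto
    moreover have "?S \<subseteq> ?A" using eq N(3) by (auto dest: inj_onD)
    ultimately show "\<exists>S. openin (top_of_set T) S \<and> s \<in> S \<and> S \<subseteq> ?A" by blast
  qed
  have 2: "openin (top_of_set T) (T - ?A)"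
  proof (subst openin_subopen, rule ballI)
    fix s assume s: "s \<in> T - ?A"
    then have "c s \<in> X" "d s \<in> X" "c s \<noteq> d s" using assms(3,5) by auto
    then obtain U V where N: "openin (top_of_set X) U" "openin (top_of_set X) V"
      "c s \<in> U" "d s \<in> V" "U \<inter> V = {}"
      using separated[of "c s" "d s"] by metis
    let ?S = "(T \<inter> c -` U) \<inter> (T \<inter> d -` V)"
    have "openin (top_of_set T) ?S"
      using N assms(2-5) by (intro openin_Int continuous_openin_preimage)
    moreover have "s \<in> ?S" using s N by auto
    moreover have "?S \<subseteq> T - ?A" using N by auto
    ultimately show "\<exists>S. openin (top_of_set T) S \<and> s \<in> S \<and> S \<subseteq> T - ?A" by blast
  qed
  have "closedin (top_of_set T) ?A" unfolding closedin_def using 2 by auto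
  with 1 have "?A = {} \<or> ?A = T" using assms(1) unfolding connected_clopen by blast
  then show ?thesis using a \<open>t \<in> T\<close> by auto
qed

lemma local_action_lift:
  fixes E :: "'v::real_normed_vector \<Rightarrow> 'c \<Rightarrow> 'c"
  assumes "\<delta> > 0"
    and loc: "\<And>x. x \<in> X \<Longrightarrow> \<exists>N \<psi>. openin (top_of_set X) N \<and> x \<in> N \<and>
      continuous_on (ball 0 \<delta> \<times> N) \<psi> \<and> \<psi> \<in> ball 0 \<delta> \<times> N \<rightarrow> X \<and>
      (\<forall>v\<in>ball 0 \<delta>. \<forall>y\<in>N. F (\<psi> (v, y)) = E v (F y)) \<and> (\<forall>y\<in>N. \<psi> (0, y) = y)"
  obtains \<psi> where "continuous_on (ball 0 \<delta> \<times> X) \<psi>" "\<psi> \<in> ball 0 \<delta> \<times> X \<rightarrow> X"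
    "\<And>v y. v \<in> ball 0 \<delta> \<Longrightarrow> y \<in> X \<Longrightarrow> F (\<psi> (v, y)) = E v (F y)"
    "\<And>y. y \<in> X \<Longrightarrow> \<psi> (0, y) = y"
proof -
  define P where "P x N \<psi> \<longleftrightarrow> openin (top_of_set X) N \<and> x \<in> N \<and>
      continuous_on (ball 0 \<delta> \<times> N) \<psi> \<and> \<psi> \<in> ball 0 \<delta> \<times> N \<rightarrow> X \<and>
      (\<forall>v\<in>ball 0 \<delta>. \<forall>y\<in>N. F (\<psi> (v, y)) = E v (F y)) \<and> (\<forall>y\<in>N. \<psi> (0, y) = y)" for x N \<psi>
  have "\<forall>x\<in>X. \<exists>N \<psi>. P x N \<psi>" using loc unfolding P_def by blast
  then obtain N \<psi>' where "\<forall>x\<in>X. P x (N x) (\<psi>' x)" by metis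
  then have N: "\<And>x. x \<in> X \<Longrightarrow> openin (top_of_set X) (N x)"
    "\<And>x. x \<in> X \<Longrightarrow> x \<in> N x"
    and cont: "\<And>x. x \<in> X \<Longrightarrow> continuous_on (ball 0 \<delta> \<times> N x) (\<psi>' x)"
    and im: "\<And>x. x \<in> X \<Longrightarrow> \<psi>' x \<in> ball 0 \<delta> \<times> N x \<rightarrow> X"
    and eq: "\<And>x v y. x \<in> X \<Longrightarrow> v \<in> ball 0 \<delta> \<Longrightarrow> y \<in> N x \<Longrightarrow> F (\<psi>' x (v, y)) = E v (F y)"
    and zero: "\<And>x y. x \<in> X \<Longrightarrow> y \<in> N x \<Longrightarrow> \<psi>' x (0, y) = y"
    unfolding P_def by blast+
  define \<psi> where "\<psi> = (\<lambda>(v, x). \<psi>' x (v, x))"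
  have same: "\<psi>' x (v, y) = \<psi> (v, y)" if "x \<in> X" "y \<in> N x" "v \<in> ball 0 \<delta>" for x y v
  proof -
    have y: "y \<in> X" using that N(1) openin_imp_subset by blast
    have c: "continuous_on (ball 0 \<delta>) (\<lambda>v. \<psi>' x (v, y))" if "x \<in> X" "y \<in> N x" for x
      by (rule continuous_on_compose2[OF cont[OF that(1)]])
         (use that in \<open>auto intro!: continuous_intros\<close>)
    show ?thesis unfolding \<psi>_def prod.case
      by (rule lift_unique[of "ball 0 \<delta>" "\<lambda>v. \<psi>' x (v, y)" "\<lambda>v. \<psi>' y (v, y)" 0])
         (use y that N im eq zero c assms(1) in \<open>auto simp: Pi_iff\<close>)
  qed
  show thesis
  proof
    show "continuous_on (ball 0 \<delta> \<times> X) \<psi>"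
    proof (rule continuous_on_openin_cover)
      fix z :: "'v \<times> 'b" assume z: "z \<in> ball 0 \<delta> \<times> X"
      show "\<exists>M. openin (top_of_set (ball 0 \<delta> \<times> X)) M \<and> z \<in> M \<and> continuous_on M \<psi>"
      proof (intro exI conjI)
        show "openin (top_of_set (ball 0 \<delta> \<times> X)) (ball 0 \<delta> \<times> N (snd z))"
          using z N by (intro openin_Times) auto
        show "z \<in> ball 0 \<delta> \<times> N (snd z)" using z N by auto
        show "continuous_on (ball 0 \<delta> \<times> N (snd z)) \<psi>"
          using cont[of "snd z"] z same by (subst continuous_on_cong[OF refl, of _ _ "\<psi>' (snd z)"]) auto
      qed
    qed
    show "\<psi> \<in> ball 0 \<delta> \<times> X \<rightarrow> X" using im N by (fastforce simp: \<psi>_def Pi_iff)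
  qed (use N eq zero in \<open>auto simp: \<psi>_def\<close>)
qed

lemma action_lift:
  fixes E :: "'v::real_normed_vector \<Rightarrow> 'c \<Rightarrow> 'c"
  assumes E0: "\<And>y. E 0 y = y" and Eadd: "\<And>v w y. E (v + w) y = E v (E w y)"
    and "\<delta> > 0"
    and loc: "\<And>x. x \<in> X \<Longrightarrow> \<exists>N \<psi>. openin (top_of_set X) N \<and> x \<in> N \<and>
      continuous_on (ball 0 \<delta> \<times> N) \<psi> \<and> \<psi> \<in> ball 0 \<delta> \<times> N \<rightarrow> X \<and>
      (\<forall>v\<in>ball 0 \<delta>. \<forall>y\<in>N. F (\<psi> (v, y)) = E v (F y)) \<and> (\<forall>y\<in>N. \<psi> (0, y) = y)"
  shows "\<exists>\<Psi>. continuous_on (ball 0 T \<times> X) \<Psi> \<and> \<Psi> \<in> ball 0 T \<times> X \<rightarrow> X \<and>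
    (\<forall>v\<in>ball 0 T. \<forall>y\<in>X. F (\<Psi> (v, y)) = E v (F y)) \<and> (\<forall>y\<in>X. \<Psi> (0, y) = y)"
proof -
  obtain \<psi> where cont: "continuous_on (ball 0 \<delta> \<times> X) \<psi>" and im: "\<psi> \<in> ball 0 \<delta> \<times> X \<rightarrow> X"
    and eq: "\<And>v y. v \<in> ball 0 \<delta> \<Longrightarrow> y \<in> X \<Longrightarrow> F (\<psi> (v, y)) = E v (F y)"
    and zero: "\<And>y. y \<in> X \<Longrightarrow> \<psi> (0, y) = y"
    using local_action_lift[OF assms(3,4)] by blast
  obtain n :: nat where n: "n > 0" "T < n * \<delta>"
  proof -
    obtain n :: nat where "T / \<delta> < n" using reals_Archimedean2 by blast
    then have "T < Suc n * \<delta>"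
      using \<open>\<delta> > 0\<close> by (auto simp: field_simps)
    then show thesis using that[of "Suc n"] by simp
  qed
  define G where "G k = (\<lambda>(v, x). ((\<lambda>y. \<psi> (v /\<^sub>R n, y)) ^^ k) x)" for k :: nat
  have small: "v /\<^sub>R n \<in> ball 0 \<delta>" if "v \<in> ball 0 T" for v :: 'v
    using that n by (simp add: field_simps)
  have G: "continuous_on (ball 0 T \<times> X) (G k) \<and> G k \<in> ball 0 T \<times> X \<rightarrow> X \<and>
      (\<forall>v\<in>ball 0 T. \<forall>y\<in>X. F (G k (v, y)) = E ((k / n) *\<^sub>R v) (F y)) \<and> (\<forall>y\<in>X. G k (0, y) = y)" for k
  proof (induction k)
    case 0
    show ?case by (auto simp: G_def E0 case_prod_beta intro!: continuous_intros)
  next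
    case (Suc k)
    have S: "G (Suc k) = (\<lambda>z. \<psi> (fst z /\<^sub>R n, G k z))" by (auto simp: G_def)
    have "continuous_on (ball 0 T \<times> X) (G (Suc k))" unfolding S
      by (rule continuous_on_compose2[OF cont])
         (use Suc small in \<open>auto intro!: continuous_intros simp del: mem_ball\<close>)
    moreover have "G (Suc k) \<in> ball 0 T \<times> X \<rightarrow> X"
      unfolding S using small im Suc by (fastforce simp: Pi_iff simp del: mem_ball)
    moreover have "F (G (Suc k) (v, y)) = E ((Suc k / n) *\<^sub>R v) (F y)"
      if "v \<in> ball 0 T" "y \<in> X" for v y
    proof -
      have "G k (v, y) \<in> X" using Suc that by auto
      then have "F (G (Suc k) (v, y)) = E (v /\<^sub>R n) (E ((k / n) *\<^sub>R v) (F y))"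
        unfolding S using eq small that Suc by (simp del: mem_ball)
      also have "\<dots> = E (v /\<^sub>R n + (k / n) *\<^sub>R v) (F y)" by (simp add: Eadd)
      also have "v /\<^sub>R n + (k / n) *\<^sub>R v = (Suc k / n) *\<^sub>R v"
      proof -
        have "inverse (real n) + k / n = Suc k / n" by (simp add: distrib_right divide_inverse)
        then show ?thesis by (metis scaleR_left_distrib)
      qed
      finally show ?thesis .
    qed
    ultimately show ?case using Suc zero by (auto simp: S)
  qed
  show ?thesis
    using G[of n] n by (intro exI[of _ "G n"]) simp
qed

text \<open>Sections through all points of a fibre that are defined on one connected neighbourhood of the
  base point are the inverses of the sheets.\<close>

lemma covering_space_if_sections:
  assumes "F ` X = S"
    and sec: "\<And>y. y \<in> S \<Longrightarrow> \<exists>U. openin (top_of_set S) U \<and> y \<in> U \<and> connected U \<and>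
      (\<forall>x \<in> X \<inter> F -` U. \<exists>s. continuous_on U s \<and> s \<in> U \<rightarrow> X \<and> (\<forall>w\<in>U. F (s w) = w) \<and> s (F x) = x)"
  shows "covering_space X F S"
  unfolding covering_space_def
proof (intro conjI ballI continuous assms(1))
  fix y assume "y \<in> S"
  then obtain U where U: "openin (top_of_set S) U" "y \<in> U" "connected U"
    and secU: "\<And>x. x \<in> X \<inter> F -` U \<Longrightarrow>
        \<exists>s. continuous_on U s \<and> s \<in> U \<rightarrow> X \<and> (\<forall>w\<in>U. F (s w) = w) \<and> s (F x) = x"
    using sec by meson
  define \<S> where "\<S> = {s. continuous_on U s \<and> s \<in> U \<rightarrow> X \<and> (\<forall>w\<in>U. F (s w) = w)}"
  have "openin (top_of_set X) (s ` U)" if "s \<in> \<S>" for s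
  proof (subst openin_subopen, clarify)
    fix w assume w: "w \<in> U"
    have s: "continuous_on U s" "s \<in> U \<rightarrow> X" "\<And>w. w \<in> U \<Longrightarrow> F (s w) = w"
      using that by (auto simp: \<S>_def)
    then obtain N where N: "openin (top_of_set X) N" "s w \<in> N" "inj_on F N"
      using locally_inj[of "s w"] w by blast
    let ?W = "N \<inter> (X \<inter> F -` (U \<inter> s -` N))"
    have "openin (top_of_set U) (U \<inter> s -` N)"
      using continuous_openin_preimage[OF s(1,2) N(1)] .
    then have "openin (top_of_set S) (U \<inter> s -` N)" using U(1) openin_trans by blast
    then have "openin (top_of_set X) ?W"
      using N(1) assms(1) continuous_openin_preimage[OF continuous, of S "U \<inter> s -` N"]
      by (simp add: openin_Int Pi_iff image_subset_iff[symmetric])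
    moreover have "s w \<in> ?W" using w s N by auto
    moreover have "?W \<subseteq> s ` U"
    proof
      fix x assume x: "x \<in> ?W"
      then have "s (F x) = x" using N(3) s(3) inj_onD[OF N(3), of "s (F x)" x] by auto
      with x show "x \<in> s ` U" by (metis IntD1 IntD2 image_eqI vimageD)
    qed
    ultimately show "\<exists>T. openin (top_of_set X) T \<and> s w \<in> T \<and> T \<subseteq> s ` U" by blast
  qed
  moreover have "\<Union> ((\<lambda>s. s ` U) ` \<S>) = X \<inter> F -` U"
  proof
    show "\<Union> ((\<lambda>s. s ` U) ` \<S>) \<subseteq> X \<inter> F -` U" by (auto simp: \<S>_def)
    show "X \<inter> F -` U \<subseteq> \<Union> ((\<lambda>s. s ` U) ` \<S>)"
    proof
      fix x assume x: "x \<in> X \<inter> F -` U"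
      with secU obtain s where "s \<in> \<S>" "s (F x) = x" by (force simp: \<S>_def)
      moreover have "F x \<in> U" using x by auto
      ultimately show "x \<in> \<Union> ((\<lambda>s. s ` U) ` \<S>)" by (metis UN_I image_eqI)
    qed
  qed
  moreover have "pairwise disjnt ((\<lambda>s. s ` U) ` \<S>)"
  proof (rule pairwise_imageI)
    fix s t assume st: "s \<in> \<S>" "t \<in> \<S>" "s ` U \<noteq> t ` U"
    show "disjnt (s ` U) (t ` U)"
    proof (rule ccontr)
      assume "\<not> disjnt (s ` U) (t ` U)"
      then obtain a b where ab: "a \<in> U" "b \<in> U" "s a = t b" by (auto simp: disjnt_def)
      then have "a = b" using st by (metis (mono_tags, lifting) \<S>_def mem_Collect_eq)
      then have "s w = t w" if "w \<in> U" for w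
        using lift_unique[of U s t a w] st ab that U(3) by (auto simp: \<S>_def)
      then show False using st(3) by (metis image_cong)
    qed
  qed
  moreover have "\<exists>q. homeomorphism (s ` U) U F q" if "s \<in> \<S>" for s
    using that continuous_on_subset[OF continuous, of "s ` U"] 
    by (intro exI[of _ s]) (auto simp: \<S>_def homeomorphism_def image_image)
  ultimately show "\<exists>T. y \<in> T \<and> openin (top_of_set S) T \<and>
      (\<exists>v. \<Union> v = X \<inter> F -` T \<and> (\<forall>u\<in>v. openin (top_of_set X) u) \<and> pairwise disjnt v \<and>
           (\<forall>u\<in>v. \<exists>q. homeomorphism u T F q))"
    using U by (intro exI[of _ U] exI[of _ "(\<lambda>s. s ` U) ` \<S>"] conjI) auto
qed

end

section \<open>The universal covering of the torus\<close>

lemma covering_space_homeomorphic_transfer: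
  assumes cov: "covering_space C p S" and h: "homeomorphism C' C h h'" and l: "homeomorphism S S' l l'"
    and p': "\<And>x. x \<in> C' \<Longrightarrow> p' x = l (p (h x))"
  shows "covering_space C' p' S'"
  unfolding covering_space_def
proof (intro conjI ballI)
  have pS: "p ` C = S" using cov by (simp add: covering_space_def)
  have "continuous_on C' (\<lambda>x. l (p (h x)))"
    by (rule continuous_on_compose2[OF homeomorphism_cont1[OF l]],
        rule continuous_on_compose2[OF covering_space_imp_continuous[OF cov]],
        rule homeomorphism_cont1[OF h])
       (use h pS in \<open>auto simp: homeomorphism_def\<close>)
  then show "continuous_on C' p'" by (simp add: p' cong: continuous_on_cong)
  have "p' ` C' = l ` p ` h ` C'" by (auto simp: p' image_iff)
  then show "p' ` C' = S'" using h l pS by (simp add: homeomorphism_def)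
  fix y assume y: "y \<in> S'"
  then have "l' y \<in> S" using l by (auto simp: homeomorphism_def)
  then obtain T v where T: "l' y \<in> T" "openin (top_of_set S) T" and v: "\<Union> v = C \<inter> p -` T"
    "\<And>u. u \<in> v \<Longrightarrow> openin (top_of_set C) u" "pairwise disjnt v" "\<And>u. u \<in> v \<Longrightarrow> \<exists>q. homeomorphism u T p q"
    using cov unfolding covering_space_def by (metis (no_types, lifting))
  have TS: "T \<subseteq> S" using T openin_imp_subset by blast
  have sub: "u \<subseteq> C" if "u \<in> v" for u using v(2) that openin_imp_subset by blast
  show "\<exists>T. y \<in> T \<and> openin (top_of_set S') T \<and>
      (\<exists>v. \<Union> v = C' \<inter> p' -` T \<and> (\<forall>u\<in>v. openin (top_of_set C') u) \<and> pairwise disjnt v \<and>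
           (\<forall>u\<in>v. \<exists>q. homeomorphism u T p' q))"
  proof (intro exI[of _ "l ` T"] exI[of _ "(`) h' ` v"] conjI ballI)
    show "y \<in> l ` T" using T(1) y l by (metis homeomorphism_apply2 image_eqI)
    show "openin (top_of_set S') (l ` T)" using homeomorphism_imp_open_map[OF l T(2)] .
    show "\<Union> ((`) h' ` v) = C' \<inter> p' -` (l ` T)"
    proof -
      have "\<Union> ((`) h' ` v) = h' ` (C \<inter> p -` T)" using v(1) by blast
      also have "\<dots> = C' \<inter> p' -` (l ` T)"
      proof (intro equalityI subsetI)
        fix x assume "x \<in> h' ` (C \<inter> p -` T)"
        then obtain c where c: "c \<in> C" "p c \<in> T" "x = h' c" by auto
        then have "x \<in> C'" "h x = c" using h by (auto simp: homeomorphism_def)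
        then show "x \<in> C' \<inter> p' -` (l ` T)" using c p' by auto
      next
        fix x assume x: "x \<in> C' \<inter> p' -` (l ` T)"
        then obtain t where t: "t \<in> T" "l (p (h x)) = l t" using p' by auto
        have hx: "h x \<in> C" "h' (h x) = x" using x h by (auto simp: homeomorphism_def)
        have "p (h x) = t" using t TS l hx pS
          by (metis homeomorphism_apply1 image_eqI subsetD)
        then show "x \<in> h' ` (C \<inter> p -` T)" using hx t by (metis IntI image_eqI vimageI)
      qed
      finally show ?thesis .
    qed
    have inj: "inj_on h' (\<Union> v)"
      using h v(1) by (intro inj_on_inverseI[of _ h]) (auto simp: homeomorphism_def)
    show "pairwise disjnt ((`) h' ` v)"
    proof (rule pairwise_imageI)
      fix s t assume st: "s \<in> v" "t \<in> v" "h' ` s \<noteq> h' ` t"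
      then have "disjnt s t" using v(3) by (metis pairwise_def)
      then show "disjnt (h' ` s) (h' ` t)"
        using disjnt_inj_on_iff[OF inj st(1,2)] by simp
    qed
    fix u' assume "u' \<in> (`) h' ` v"
    then obtain u where u: "u \<in> v" "u' = h' ` u" by auto
    show "openin (top_of_set C') u'"
      unfolding u using homeomorphism_imp_open_map[OF homeomorphism_symD[OF h] v(2)[OF u(1)]] .
    obtain q where q: "homeomorphism u T p q" using v(4) u by blast
    have "\<And>c. c \<in> u \<Longrightarrow> h (h' c) = c" using homeomorphism_apply2[OF h] sub[OF u(1)] by blast
    then have hu: "h ` u' = u" by (simp add: u(2) image_image)
    have u'C: "u' \<subseteq> C'" using homeomorphism_image2[OF h] sub[OF u(1)] u(2) by blast
    have "homeomorphism u' u h h'" by (rule homeomorphism_of_subsets[OF h u'C order_refl hu])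
    moreover have "homeomorphism T (l ` T) l l'"
      by (rule homeomorphism_of_subsets[OF l TS order_refl refl])
    ultimately have "homeomorphism u' (l ` T) (l \<circ> (p \<circ> h)) ((h' \<circ> q) \<circ> l')"
      using q homeomorphism_compose by (metis (no_types, lifting))
    then have "homeomorphism u' (l ` T) p' ((h' \<circ> q) \<circ> l')"
    proof (rule homeomorphism_cong)
      show "p' x = (l \<circ> (p \<circ> h)) x" if "x \<in> u'" for x
        using that u'C p' by auto
    qed auto
    then show "\<exists>q. homeomorphism u' (l ` T) p' q" by blast
  qed
qed

lemma unramified_t2I:
  fixes X :: "'b::t2_space set"
  assumes "continuous_on X F" "\<And>x. x \<in> X \<Longrightarrow> \<exists>N. openin (top_of_set X) N \<and> x \<in> N \<and> inj_on F N"
  shows "unramified X F"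
proof
  fix x y assume "x \<in> X" "y \<in> X" "x \<noteq> y"
  moreover obtain U V where "open U" "open V" "x \<in> U" "y \<in> V" "U \<inter> V = {}"
    using hausdorff[OF \<open>x \<noteq> y\<close>] by blast
  ultimately show "\<exists>U V. openin (top_of_set X) U \<and> openin (top_of_set X) V \<and> x \<in> U \<and> y \<in> V \<and> U \<inter> V = {}"
    by (intro exI[of _ "X \<inter> U"] exI[of _ "X \<inter> V"]) auto
qed (use assms in auto)

lemma covering_space_imp_unramified:
  fixes S :: "'c::t2_space set"
  assumes cov: "covering_space X F S"
  shows "unramified X F"
proof
  show cont: "continuous_on X F" using covering_space_imp_continuous[OF cov] .
  have FS: "F ` X = S" using covering_space_imp_surjective[OF cov] .
  have ev: "\<exists>T v. F x \<in> T \<and> \<Union> v = X \<inter> F -` T \<and> (\<forall>u\<in>v. openin (top_of_set X) u) \<and>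
      pairwise disjnt v \<and> (\<forall>u\<in>v. inj_on F u)" if x: "x \<in> X" for x
  proof -
    have "F x \<in> S" using x FS by blast
    then obtain T v where "F x \<in> T" "\<Union> v = X \<inter> F -` T" "\<forall>u\<in>v. openin (top_of_set X) u"
      "pairwise disjnt v" "\<forall>u\<in>v. \<exists>q. homeomorphism u T F q"
      using cov unfolding covering_space_def by (metis (no_types, lifting))
    moreover have "inj_on F u" if "homeomorphism u T F q" for u q
      using that by (metis homeomorphism_def inj_on_inverseI)
    ultimately show ?thesis by meson
  qed
  show "\<exists>N. openin (top_of_set X) N \<and> x \<in> N \<and> inj_on F N" if "x \<in> X" for x
    using ev[OF that] that by blast
  fix x y assume xy: "x \<in> X" "y \<in> X" "x \<noteq> y"
  show "\<exists>U V. openin (top_of_set X) U \<and> openin (top_of_set X) V \<and> x \<in> U \<and> y \<in> V \<and> U \<inter> V = {}"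
  proof (cases "F x = F y")
    case False
    then obtain U V where "open U" "open V" "F x \<in> U" "F y \<in> V" "U \<inter> V = {}"
      using hausdorff[OF False] by blast
    then show ?thesis using xy cont
      by (intro exI[of _ "X \<inter> F -` U"] exI[of _ "X \<inter> F -` V"])
         (auto simp: continuous_openin_preimage_gen)
  next
    case True
    obtain T v where v: "F x \<in> T" "\<Union> v = X \<inter> F -` T" "\<forall>u\<in>v. openin (top_of_set X) u"
      "pairwise disjnt v" "\<forall>u\<in>v. inj_on F u"
      using ev[OF xy(1)] by (elim exE conjE) (rule that)
    have "x \<in> \<Union> v" "y \<in> \<Union> v" using v(1,2) xy True by auto
    then obtain U V where UV: "U \<in> v" "V \<in> v" "x \<in> U" "y \<in> V" by blast
    have "U \<noteq> V" using v(5) UV xy True by (metis inj_onD)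
    then have "U \<inter> V = {}" using v(4) UV by (auto simp: pairwise_def disjnt_def)
    then show ?thesis using v(3) UV by blast
  qed
qed

definition torus_exp :: "complex \<Rightarrow> complex \<times> complex" where
  "torus_exp z = (cis (Re z), cis (Im z))"

definition torus_act :: "complex \<Rightarrow> complex \<times> complex \<Rightarrow> complex \<times> complex" where
  "torus_act v y = (fst y * cis (Re v), snd y * cis (Im v))"

lemma torus_exp_add: "torus_exp (v + w) = torus_act v (torus_exp w)"
  by (simp add: torus_exp_def torus_act_def cis_mult add.commute)

lemma torus_act_add: "torus_act (v + w) y = torus_act v (torus_act w y)"
  by (simp add: torus_act_def cis_mult[symmetric] mult_ac)

lemma torus_act_0 [simp]: "torus_act 0 y = y"
  by (simp add: torus_act_def)

lemma torus_act_one [simp]: "torus_act v (torus_exp 0) = torus_exp v"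
  using torus_exp_add[of v 0] by simp

lemma continuous_on_torus_exp: "continuous_on A torus_exp"
  unfolding torus_exp_def by (intro continuous_intros)

lemma torus_exp_in_torus [simp]: "torus_exp z \<in> torus"
  by (simp add: torus_exp_def torus_def)

lemma torus_act_in_torus [simp]: "y \<in> torus \<Longrightarrow> torus_act v y \<in> torus"
  by (auto simp: torus_act_def torus_def norm_mult)

lemma dist_torus_act:
  assumes "y \<in> torus"
  shows "dist (torus_act v y) y = dist (torus_exp v) (torus_exp 0)"
proof -
  have "dist (a * c) a = dist c 1" if "norm a = 1" for a c :: complex
    using that by (metis dist_norm mult.right_neutral mult_cancel_right2 norm_mult right_diff_distrib)
  then show ?thesis using assms
    by (auto simp: torus_act_def torus_exp_def torus_def dist_prod_def)
qed

text \<open>The branch of the inverse of \<open>torus_exp\<close> near \<open>torus_exp z0\<close> that takes the value \<open>z0\<close> there.\<close>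

definition torus_log :: "complex \<Rightarrow> complex \<times> complex \<Rightarrow> complex" where
  "torus_log z0 w = z0 + Complex (Im (Ln (fst w * cis (- Re z0)))) (Im (Ln (snd w * cis (- Im z0))))"

definition torus_box :: "complex \<Rightarrow> complex set" where
  "torus_box z0 = {z. \<bar>Re z - Re z0\<bar> < pi / 2 \<and> \<bar>Im z - Im z0\<bar> < pi / 2}"

definition torus_nhd :: "complex \<Rightarrow> (complex \<times> complex) set" where
  "torus_nhd z0 = torus \<inter> {w. Re (fst w * cis (- Re z0)) > 0 \<and> Re (snd w * cis (- Im z0)) > 0}"

lemma Im_Ln_cis: "\<bar>t\<bar> < pi \<Longrightarrow> Im (Ln (cis t)) = t"
  by (simp add: cis_conv_exp)

lemma torus_log_exp:
  assumes "z \<in> torus_box z0"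
  shows "torus_log z0 (torus_exp z) = z"
proof -
  have "\<bar>Re z - Re z0\<bar> < pi" "\<bar>Im z - Im z0\<bar> < pi"
    using assms pi_gt_zero unfolding torus_box_def mem_Collect_eq by linarith+
  then show ?thesis
    by (simp add: torus_log_def torus_exp_def cis_mult Im_Ln_cis complex_eq_iff)
qed

lemma torus_exp_log:
  assumes "w \<in> torus"
  shows "torus_exp (torus_log z0 w) = w"
proof -
  have *: "cis (a + Im (Ln (c * cis (- a)))) = c" if "norm c = 1" for a c
  proof -
    have nz: "c * cis (- a) \<noteq> 0" using that by auto
    have "cis (Im (Ln (c * cis (- a)))) = c * cis (- a)"
      using exp_Ln[OF nz] that by (simp add: exp_eq_polar norm_mult)
         (metis Re_Ln nz norm_mult norm_cis mult_1_right ln_one exp_zero of_real_1 mult_1)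
    then have "cis (a + Im (Ln (c * cis (- a)))) = c * (cis a * cis (- a))"
      by (simp add: cis_mult[symmetric] mult_ac)
    then show ?thesis by (simp add: cis_mult)
  qed
  then show ?thesis using assms
    by (cases w) (simp add: torus_exp_def torus_log_def torus_def)
qed

lemma torus_box_nhd: "torus_exp ` torus_box z0 = torus_nhd z0"
proof (intro equalityI subsetI)
  fix w assume "w \<in> torus_exp ` torus_box z0"
  then obtain z where z: "z \<in> torus_box z0" "w = torus_exp z" by blast
  have "cos (Re z - Re z0) > 0" "cos (Im z - Im z0) > 0"
    using z(1) unfolding torus_box_def mem_Collect_eq abs_less_iff
    by (intro cos_gt_zero_pi; linarith)+
  then show "w \<in> torus_nhd z0"
    by (simp add: z(2) torus_nhd_def torus_exp_def torus_def cis_mult cos_diff)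
next
  fix w assume w: "w \<in> torus_nhd z0"
  have "fst w * cis (- Re z0) \<noteq> 0" "snd w * cis (- Im z0) \<noteq> 0"
    using w by (auto simp: torus_nhd_def)
  then have "\<bar>Im (Ln (fst w * cis (- Re z0)))\<bar> < pi / 2" "\<bar>Im (Ln (snd w * cis (- Im z0)))\<bar> < pi / 2"
    using w Re_Ln_pos_lt unfolding torus_nhd_def by blast+
  then have "torus_log z0 w \<in> torus_box z0" by (simp add: torus_log_def torus_box_def)
  moreover have "torus_exp (torus_log z0 w) = w" using w by (simp add: torus_nhd_def torus_exp_log)
  ultimately show "w \<in> torus_exp ` torus_box z0" by (metis image_eqI)
qed

lemma openin_torus_nhd: "openin (top_of_set torus) (torus_nhd z0)"
proof -
  have "open {w::complex \<times> complex. Re (fst w * cis (- Re z0)) > 0 \<and> Re (snd w * cis (- Im z0)) > 0}"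
    by (intro open_Collect_conj open_Collect_less continuous_intros)
  then show ?thesis unfolding torus_nhd_def by blast
qed

lemma torus_box_self: "z \<in> torus_box z" by (simp add: torus_box_def)

lemma convex_torus_box: "convex (torus_box z0)"
proof -
  have "torus_box z0 = {z. Re z < Re z0 + pi/2} \<inter> {z. Re z > Re z0 - pi/2} \<inter>
      {z. Im z < Im z0 + pi/2} \<inter> {z. Im z > Im z0 - pi/2}"
    by (intro set_eqI; simp only: torus_box_def mem_Collect_eq Int_iff; linarith)
  then show ?thesis
    by (simp add: convex_Int convex_halfspace_Re_lt convex_halfspace_Re_gt
        convex_halfspace_Im_lt convex_halfspace_Im_gt)
qed

lemma open_torus_box: "open (torus_box z0)"
  unfolding torus_box_def by (intro open_Collect_conj open_Collect_less continuous_intros)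

lemma continuous_on_torus_log: "continuous_on (torus_nhd z0) (torus_log z0)"
proof -
  have *: "c \<notin> \<real>\<^sub>\<le>\<^sub>0" if "Re c > 0" for c using that by (auto simp: complex_nonpos_Reals_iff)
  show ?thesis unfolding torus_log_def
    by (intro continuous_intros *) (auto simp: torus_nhd_def)
qed

lemma torus_exp_surj: "range torus_exp = torus"
  using torus_exp_log by (metis image_subsetI rangeI subsetI subset_antisym torus_exp_in_torus)

interpretation torus_exp: unramified UNIV torus_exp
proof (rule unramified_t2I)
  fix x :: complex
  show "\<exists>N. openin (top_of_set UNIV) N \<and> x \<in> N \<and> inj_on torus_exp N"
    by (intro exI[of _ "torus_box x"]) 
       (auto simp: torus_box_self open_torus_box intro!: inj_on_inverseI torus_log_exp)
qed (rule continuous_on_torus_exp)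

lemma covering_space_torus_exp: "covering_space UNIV torus_exp torus"
proof (rule torus_exp.covering_space_if_sections[OF torus_exp_surj])
  fix y assume "y \<in> torus"
  then obtain z0 where z0: "y = torus_exp z0" using torus_exp_surj by auto
  show "\<exists>U. openin (top_of_set torus) U \<and> y \<in> U \<and> connected U \<and>
      (\<forall>x\<in>UNIV \<inter> torus_exp -` U. \<exists>s. continuous_on U s \<and> s \<in> U \<rightarrow> UNIV \<and>
         (\<forall>w\<in>U. torus_exp (s w) = w) \<and> s (torus_exp x) = x)"
  proof (intro exI[of _ "torus_nhd z0"] conjI ballI)
    show "openin (top_of_set torus) (torus_nhd z0)" by (rule openin_torus_nhd)
    show "y \<in> torus_nhd z0" unfolding z0 using torus_box_nhd torus_box_self by blast
    show "connected (torus_nhd z0)"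
      unfolding torus_box_nhd[symmetric]
      by (intro connected_continuous_image continuous_on_torus_exp convex_connected convex_torus_box)
    fix x assume "x \<in> UNIV \<inter> torus_exp -` torus_nhd z0"
    define d where "d = x - torus_log z0 (torus_exp x)"
    have "torus_exp (d + torus_log z0 (torus_exp x)) = torus_exp x" by (simp add: d_def)
    then have eq: "torus_act d (torus_exp x) = torus_exp x" by (simp add: torus_exp_add torus_exp_log)
    have "torus_act d w = w" for w
    proof -
      have "cis (Re d) = 1" "cis (Im d) = 1" using eq by (auto simp: torus_act_def torus_exp_def)
      then show ?thesis by (simp add: torus_act_def)
    qed
    then have "torus_exp (d + torus_log z0 w) = w" if "w \<in> torus_nhd z0" for w
      using that by (simp add: torus_exp_add torus_exp_log torus_nhd_def)
    then show "\<exists>s. continuous_on (torus_nhd z0) s \<and> s \<in> torus_nhd z0 \<rightarrow> UNIV \<and>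
         (\<forall>w\<in>torus_nhd z0. torus_exp (s w) = w) \<and> s (torus_exp x) = x"
      by (intro exI[of _ "\<lambda>w. d + torus_log z0 w"])
         (auto intro!: continuous_intros continuous_on_torus_log simp: d_def)
  qed
qed

lemma compact_torus: "compact torus"
  unfolding torus_def by (intro compact_Times compact_sphere)

text \<open>The translation action of the plane on the torus lifts to the covering space, and the orbit map of
  a point is the required parametrisation.\<close>

lemma torus_covering_parametrisation:
  fixes X :: "'b::topological_space set"
  assumes cov: "covering_space X q torus" and sc: "simply_connected X"
  obtains u k where "homeomorphism UNIV X u k" "\<And>z. q (u z) = torus_exp z"
proof -
  interpret unramified X q by (rule covering_space_imp_unramified[OF cov])
  have im: "q ` X = torus" using covering_space_imp_surjective[OF cov] .
  define \<G> where "\<G> = {O'. open O' \<and> (\<forall>x\<in>X. q x \<in> O' \<longrightarrow>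
     (\<exists>W r. openin (top_of_set X) W \<and> x \<in> W \<and> homeomorphism W (torus \<inter> O') q r))}"
  have "torus \<subseteq> \<Union>\<G>"
  proof
    fix y assume y: "y \<in> torus"
    then obtain T v where T: "y \<in> T" "openin (top_of_set torus) T" and v: "\<Union> v = X \<inter> q -` T"
      "\<And>u. u \<in> v \<Longrightarrow> openin (top_of_set X) u" "\<And>u. u \<in> v \<Longrightarrow> \<exists>r. homeomorphism u T q r"
      using cov unfolding covering_space_def by (metis (no_types, lifting))
    obtain O' where O': "open O'" "T = torus \<inter> O'" using T(2) by (auto simp: openin_open)
    have "O' \<in> \<G>" unfolding \<G>_def
    proof (intro CollectI conjI ballI impI O'(1))
      fix x assume "x \<in> X" "q x \<in> O'"
      then have "x \<in> \<Union> v" using v(1) im O' by auto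
      then show "\<exists>W r. openin (top_of_set X) W \<and> x \<in> W \<and> homeomorphism W (torus \<inter> O') q r"
        using v(2,3) O'(2) by (metis UnionE)
    qed
    then show "y \<in> \<Union>\<G>" using T(1) O'(2) by blast
  qed
  moreover have "\<And>G. G \<in> \<G> \<Longrightarrow> open G" by (simp add: \<G>_def)
  ultimately obtain \<epsilon> where \<epsilon>: "\<epsilon> > 0" "\<And>y. y \<in> torus \<Longrightarrow> \<exists>G\<in>\<G>. ball y \<epsilon> \<subseteq> G"
    by (rule Heine_Borel_lemma[OF compact_torus]) (auto intro: that)
  have "isCont torus_exp 0"
    using continuous_on_torus_exp[of UNIV] by (simp add: continuous_on_eq_continuous_at)
  then obtain \<delta> where \<delta>: "\<delta> > 0" "\<And>v. dist v 0 < \<delta> \<Longrightarrow> dist (torus_exp v) (torus_exp 0) < \<epsilon> / 2"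
    unfolding continuous_at_eps_delta using \<epsilon>(1) half_gt_zero by blast
  have loc: "\<exists>N \<psi>. openin (top_of_set X) N \<and> x \<in> N \<and>
      continuous_on (ball 0 \<delta> \<times> N) \<psi> \<and> \<psi> \<in> ball 0 \<delta> \<times> N \<rightarrow> X \<and>
      (\<forall>v\<in>ball 0 \<delta>. \<forall>y\<in>N. q (\<psi> (v, y)) = torus_act v (q y)) \<and> (\<forall>y\<in>N. \<psi> (0, y) = y)"
    if x: "x \<in> X" for x
  proof -
    have qx: "q x \<in> torus" using x im by blast
    obtain G where G: "G \<in> \<G>" "ball (q x) \<epsilon> \<subseteq> G" using \<epsilon>(2)[OF qx] by blast
    have "q x \<in> G" using G(2) \<epsilon>(1) by auto
    then obtain W r where W: "openin (top_of_set X) W" "x \<in> W" "homeomorphism W (torus \<inter> G) q r"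
      using G(1) x unfolding \<G>_def by blast
    define N where "N = W \<inter> (X \<inter> q -` ball (q x) (\<epsilon> / 2))"
    have NX: "N \<subseteq> X" by (auto simp: N_def)
    have act: "torus_act v (q y) \<in> torus \<inter> G" if "v \<in> ball 0 \<delta>" "y \<in> N" for v y
    proof -
      have qy: "q y \<in> torus" using that NX im by blast
      have "dist (torus_act v (q y)) (q y) < \<epsilon> / 2"
        using \<delta>(2)[of v] that(1) dist_torus_act[OF qy] by (simp add: dist_commute)
      moreover have "dist (q x) (q y) < \<epsilon> / 2" using that(2) by (simp add: N_def)
      ultimately have "dist (q x) (torus_act v (q y)) < \<epsilon>"
        by (metis dist_commute dist_triangle_half_l)
      then show ?thesis using G(2) qy by auto
    qed
    show ?thesis
    proof (intro exI[of _ N] exI[of _ "\<lambda>(v, y). r (torus_act v (q y))"] conjI)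
      show "openin (top_of_set X) N" unfolding N_def
        by (intro openin_Int W(1) continuous_openin_preimage_gen continuous) auto
      show "x \<in> N" using x W \<epsilon>(1) by (simp add: N_def)
      have "continuous_on (ball 0 \<delta> \<times> N) (\<lambda>z. torus_act (fst z) (q (snd z)))"
        unfolding torus_act_def
        by (intro continuous_intros continuous_on_compose2[OF continuous])
           (use NX in \<open>auto intro!: continuous_intros\<close>)
      then show "continuous_on (ball 0 \<delta> \<times> N) (\<lambda>(v, y). r (torus_act v (q y)))"
        unfolding case_prod_beta
        by (rule continuous_on_compose2[OF homeomorphism_cont2[OF W(3)]]) (use act in auto)
      have "r y \<in> W" if "y \<in> torus \<inter> G" for y using that homeomorphism_image2[OF W(3)] by blast
      then show "(\<lambda>(v, y). r (torus_act v (q y))) \<in> ball 0 \<delta> \<times> N \<rightarrow> X"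
        using act W(1) openin_imp_subset by fast
      show "\<forall>v\<in>ball 0 \<delta>. \<forall>y\<in>N. q (case (v, y) of (v, y) \<Rightarrow> r (torus_act v (q y))) = torus_act v (q y)"
        using act homeomorphism_apply2[OF W(3)] by simp
      show "\<forall>y\<in>N. (case (0, y) of (v, y) \<Rightarrow> r (torus_act v (q y))) = y"
        using homeomorphism_apply1[OF W(3)] by (simp add: N_def)
    qed
  qed
  obtain m0 where m0: "m0 \<in> X" "q m0 = torus_exp 0"
    using im torus_exp_in_torus by (metis imageE)
  define P where "P T w \<longleftrightarrow> continuous_on (ball 0 T) w \<and> w \<in> ball 0 T \<rightarrow> X \<and>
      (\<forall>v\<in>ball 0 T. q (w v) = torus_exp v) \<and> w 0 = m0" for T w
  have "\<exists>w. P T w" for T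
  proof -
    have "\<exists>\<Psi>. continuous_on (ball 0 T \<times> X) \<Psi> \<and> \<Psi> \<in> ball 0 T \<times> X \<rightarrow> X \<and>
        (\<forall>v\<in>ball 0 T. \<forall>y\<in>X. q (\<Psi> (v, y)) = torus_act v (q y)) \<and> (\<forall>y\<in>X. \<Psi> (0, y) = y)"
      by (rule action_lift[OF torus_act_0 torus_act_add \<delta>(1)]) (rule loc)
    then obtain \<Psi> where \<Psi>: "continuous_on (ball 0 T \<times> X) \<Psi>" "\<Psi> \<in> ball 0 T \<times> X \<rightarrow> X"
      "\<forall>v\<in>ball 0 T. \<forall>y\<in>X. q (\<Psi> (v, y)) = torus_act v (q y)" "\<forall>y\<in>X. \<Psi> (0, y) = y"
      by (elim exE conjE) (rule that)
    have "P T (\<lambda>v. \<Psi> (v, m0))" unfolding P_def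
    proof (intro conjI)
      show "continuous_on (ball 0 T) (\<lambda>v. \<Psi> (v, m0))"
        by (rule continuous_on_compose2[OF \<Psi>(1)]) (use m0 in \<open>auto intro!: continuous_intros\<close>)
    qed (use \<Psi>(2-4) m0 in auto)
    then show ?thesis by blast
  qed
  then obtain w where w: "\<And>T. P T (w T)" by metis
  have w_cont: "\<And>T. continuous_on (ball 0 T) (w T)" and w_im: "\<And>T. w T \<in> ball 0 T \<rightarrow> X"
    and w_q: "\<And>T v. v \<in> ball 0 T \<Longrightarrow> q (w T v) = torus_exp v" and w_0: "\<And>T. w T 0 = m0"
    using w unfolding P_def by blast+
  define u where "u v = w (norm v + 1) v" for v
  have u_eq: "u v = w T v" if "v \<in> ball 0 T" for v T
  proof -
    have *: "continuous_on (ball 0 R) (w T)" "w T \<in> ball 0 R \<rightarrow> X"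
      "\<And>t. t \<in> ball 0 R \<Longrightarrow> q (w T t) = torus_exp t" if "R \<le> T" for R T
    proof -
      have sub: "ball 0 R \<subseteq> ball (0::complex) T" using that by (rule subset_ball)
      show "continuous_on (ball 0 R) (w T)" using continuous_on_subset[OF w_cont sub] .
      show "w T \<in> ball 0 R \<rightarrow> X" using w_im sub by fast
      show "q (w T t) = torus_exp t" if "t \<in> ball 0 R" for t using w_q sub that by blast
    qed
    define R where "R = min T (norm v + 1)"
    have R: "R \<le> T" "R \<le> norm v + 1" "v \<in> ball 0 R" "0 < R"
      using that unfolding R_def by (auto intro: le_less_trans[OF norm_ge_zero] add_nonneg_pos)
    show ?thesis unfolding u_def
      by (rule lift_unique[of "ball 0 R" "w (norm v + 1)" "w T" 0])
         (use R * w_0 in auto)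
  qed
  have u_cont: "continuous_on UNIV u"
  proof (rule continuous_on_openin_cover)
    fix v :: complex
    have "continuous_on (ball 0 (norm v + 1)) u"
      by (rule continuous_on_eq[OF w_cont]) (rule u_eq[symmetric])
    then show "\<exists>N. openin (top_of_set UNIV) N \<and> v \<in> N \<and> continuous_on N u"
      by (intro exI[of _ "ball 0 (norm v + 1)"]) auto
  qed
  have u_im: "u v \<in> X" for v using w_im[of "norm v + 1"] by (simp add: u_def Pi_iff)
  have u_q: "q (u v) = torus_exp v" for v using w_q[of v "norm v + 1"] by (simp add: u_def)
  have u_0: "u 0 = m0" by (simp add: u_def w_0)
  have "X \<subseteq> range u"
  proof
    fix m assume m: "m \<in> X"
    have "homotopic_loops X (\<lambda>_. m0) (\<lambda>_. m)"
      using sc m m0(1) unfolding simply_connected_def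
      by (simp add: path_def pathfinish_def pathstart_def path_image_def image_subset_iff)
    then obtain h where h: "continuous_on ({0..1::real} \<times> {0..1::real}) h" "h \<in> ({0..1} \<times> {0..1}) \<rightarrow> X"
      "\<And>x. x \<in> {0..1} \<Longrightarrow> h (0, x) = m0" "\<And>x. x \<in> {0..1} \<Longrightarrow> h (1, x) = m"
      unfolding homotopic_loops by blast
    define r where "r s = h (s, 0::real)" for s
    have r_cont: "continuous_on {0..1} r" unfolding r_def
      by (rule continuous_on_compose2[OF h(1)]) (auto intro!: continuous_intros)
    have r: "r \<in> {0..1} \<rightarrow> X" "r 0 = m0" "r 1 = m" using h(2-4) by (auto simp: r_def)
    have "path (q \<circ> r)" unfolding path_def
      by (intro continuous_on_compose r_cont continuous_on_subset[OF continuous]) (use r in auto)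
    moreover have "path_image (q \<circ> r) \<subseteq> torus" using r(1) im by (auto simp: path_image_def)
    moreover have "pathstart (q \<circ> r) = torus_exp 0" using r m0 by (simp add: pathstart_def)
    ultimately obtain c where c: "path c" "pathstart c = 0" "\<And>t. t \<in> {0..1} \<Longrightarrow> torus_exp (c t) = (q \<circ> r) t"
      by (rule covering_space_lift_path_strong[OF covering_space_torus_exp UNIV_I]) (rule that)
    have "(u \<circ> c) 1 = r 1"
    proof (rule lift_unique[of "{0..1}" "u \<circ> c" r 0])
      show "continuous_on {0..1} (u \<circ> c)"
        using c(1) continuous_on_subset[OF u_cont] by (intro continuous_on_compose) (auto simp: path_def)
    qed (use c r r_cont u_im u_q u_0 in \<open>auto simp: pathstart_def\<close>)
    then show "m \<in> range u" using r(3) by auto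
  qed
  moreover have inj: "inj u"
  proof (rule injI)
    fix a b assume ab: "u a = u b"
    let ?c = "linepath a b"
    have "path (u \<circ> ?c)" unfolding path_def
      by (intro continuous_on_compose continuous_on_subset[OF u_cont]) (auto intro!: continuous_intros)
    then have "homotopic_loops X (u \<circ> ?c) (\<lambda>_. m0)"
      using sc m0(1) ab u_im unfolding simply_connected_def
      by (simp add: path_def pathfinish_def pathstart_def path_image_def image_subset_iff linepath_def)
    then have "homotopic_loops torus (q \<circ> (u \<circ> ?c)) (q \<circ> (\<lambda>_. m0))"
      by (rule homotopic_loops_continuous_image[OF _ continuous]) (use im in auto)
    also have "q \<circ> (u \<circ> ?c) = torus_exp \<circ> ?c" by (simp add: fun_eq_iff u_q)
    also have "q \<circ> (\<lambda>_. m0) = linepath (q m0) (q m0)" by (simp add: fun_eq_iff linepath_refl)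
    finally have null: "homotopic_loops torus (torus_exp \<circ> ?c) (linepath (q m0) (q m0))" .
    have "pathstart (torus_exp \<circ> ?c) = torus_exp a" by (simp add: pathstart_def linepath_def)
    then have "homotopic_paths torus (torus_exp \<circ> ?c) (linepath (torus_exp a) (torus_exp a))"
      using homotopic_loops_imp_homotopic_paths_null[OF null] by simp
    then have "pathfinish ?c = pathfinish (linepath a a)"
      by (rule covering_space_monodromy[OF covering_space_torus_exp, rotated 4])
         (use homotopic_paths_imp_path homotopic_paths_imp_subset in
            \<open>auto simp: path_image_def linepath_refl linepath_0' path_def pathstart_def
               intro!: continuous_intros continuous_on_torus_exp
               continuous_on_compose2[OF continuous_on_torus_exp[of UNIV]]\<close>)
    then show "a = b" by simp
  qed
  ultimately have range: "range u = X" using u_im by auto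
  have k: "inv u (u z) = z" for z using inj by simp
  have "continuous_on X (inv u)"
  proof (rule continuous_on_openin_cover)
    fix m assume m: "m \<in> X"
    then obtain a where a: "m = u a" using range by blast
    obtain W where W: "openin (top_of_set X) W" "m \<in> W" "inj_on q W" using locally_inj[OF m] by blast
    define V where "V = X \<inter> q -` torus_nhd a"
    have V: "openin (top_of_set X) V" unfolding V_def
      by (rule continuous_openin_preimage[OF continuous _ openin_torus_nhd]) (use im in auto)
    have lc: "continuous_on V (\<lambda>x. torus_log a (q x))"
      by (rule continuous_on_compose2[OF continuous_on_torus_log continuous_on_subset[OF continuous]])
         (auto simp: V_def)
    have "continuous_on V (\<lambda>x. u (torus_log a (q x)))"
      by (rule continuous_on_compose2[OF u_cont lc]) auto
    then have N: "openin (top_of_set V) (V \<inter> (\<lambda>x. u (torus_log a (q x))) -` W)"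
      by (rule continuous_openin_preimage[OF _ _ W(1)]) (use u_im in auto)
    define N where "N = W \<inter> (V \<inter> (\<lambda>x. u (torus_log a (q x))) -` W)"
    have "openin (top_of_set X) N" unfolding N_def
      using openin_Int[OF W(1) openin_trans[OF N V]] .
    moreover have "m \<in> N"
      using m W(2) torus_box_nhd[of a] torus_box_self[of a] by (auto simp: N_def V_def a u_q torus_log_exp)
    moreover have "continuous_on N (inv u)"
    proof -
      have "inv u x = torus_log a (q x)" if "x \<in> N" for x
      proof -
        have "q x \<in> torus" using that by (auto simp: N_def V_def torus_nhd_def)
        then have "q (u (torus_log a (q x))) = q x" by (simp add: u_q torus_exp_log)
        then have "u (torus_log a (q x)) = x" using W(3) that by (auto simp: N_def dest: inj_onD)
        then show ?thesis using k by metis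
      qed
      moreover have "continuous_on N (\<lambda>x. torus_log a (q x))"
        by (rule continuous_on_subset[OF lc]) (auto simp: N_def)
      ultimately show ?thesis by (simp cong: continuous_on_cong)
    qed
    ultimately show "\<exists>N. openin (top_of_set X) N \<and> m \<in> N \<and> continuous_on N (inv u)" by blast
  qed
  then have "homeomorphism UNIV X u (inv u)"
    using u_cont range k by (auto simp: homeomorphism_def image_image)
  then show thesis using u_q that by blast
qed

section \<open>Holonomy of the development map\<close>

lemma development_map_local:
  assumes flat: "flat_affine_structure M \<A>" and cov: "covering_space Mt p M"
    and dev: "development_map Mt (inherited_structure Mt p \<A>) D" and m: "m \<in> Mt"
  obtains g U \<phi> N where "g \<in> Aff2" "(U, \<phi>) \<in> \<A>" "openin (top_of_set Mt) N" "m \<in> N"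
    "N \<subseteq> Mt \<inter> p -` U" "inj_on p N" "\<And>y. y \<in> N \<Longrightarrow> D y = g (\<phi> (p y))"
proof -
  have pM: "p m \<in> M" and cont: "continuous_on Mt p" and im: "p ` Mt = M"
    using m cov by (auto simp: covering_space_def)
  then have "p m \<in> (\<Union>c\<in>\<A>. fst c)" using flat by (simp add: flat_affine_structure_def)
  then obtain U \<phi> where U: "(U, \<phi>) \<in> \<A>" "p m \<in> U" by auto
  have ch: "is_chart M (U, \<phi>)" using flat U(1) unfolding flat_affine_structure_def by blast
  then obtain \<phi>' where \<phi>: "openin (top_of_set M) U" "open (\<phi> ` U)" "homeomorphism U (\<phi> ` U) \<phi> \<phi>'"
    by (auto simp: is_chart_def)
  obtain T v where T: "p m \<in> T" "openin (top_of_set M) T" and v: "\<Union> v = Mt \<inter> p -` T"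
    "\<And>u. u \<in> v \<Longrightarrow> openin (top_of_set Mt) u" "\<And>u. u \<in> v \<Longrightarrow> \<exists>q. homeomorphism u T p q"
    using cov pM unfolding covering_space_def by (metis (no_types, lifting))
  have "m \<in> \<Union> v" using v(1) m T(1) by auto
  then obtain W0 r where W0: "openin (top_of_set Mt) W0" "m \<in> W0" "homeomorphism W0 T p r"
    using v(2,3) by blast
  define W where "W = W0 \<inter> (Mt \<inter> p -` U)"
  define \<psi> where "\<psi> = \<phi> \<circ> p"
  have W_open: "openin (top_of_set Mt) W" unfolding W_def
    by (intro openin_Int W0(1) continuous_openin_preimage[OF cont _ \<phi>(1)]) (use im in auto)
  have mW: "m \<in> W" using W0 m U by (simp add: W_def)
  have TM: "T \<subseteq> M" and W0Mt: "W0 \<subseteq> Mt" using T(2) W0(1) openin_imp_subset by blast+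
  have pW: "p ` W = U \<inter> T"
  proof
    show "p ` W \<subseteq> U \<inter> T" using homeomorphism_image1[OF W0(3)] by (auto simp: W_def)
    show "U \<inter> T \<subseteq> p ` W"
    proof
      fix x assume x: "x \<in> U \<inter> T"
      then have "r x \<in> W0" "p (r x) = x"
        using homeomorphism_image2[OF W0(3)] homeomorphism_apply2[OF W0(3)] by auto
      then show "x \<in> p ` W" using x W0Mt by (auto simp: W_def intro!: image_eqI[of x p "r x"])
    qed
  qed
  have hp: "homeomorphism W (U \<inter> T) p r"
    by (rule homeomorphism_of_subsets[OF W0(3) _ order_refl pW]) (auto simp: W_def)
  have h\<phi>: "homeomorphism (U \<inter> T) (\<phi> ` (U \<inter> T)) \<phi> \<phi>'"
    by (rule homeomorphism_of_subsets[OF \<phi>(3) _ order_refl refl]) auto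
  have \<psi>W: "\<psi> ` W = \<phi> ` (U \<inter> T)" unfolding \<psi>_def image_comp[symmetric] pW ..
  have "openin (top_of_set U) (U \<inter> T)"
    using T(2) openin_imp_subset[OF \<phi>(1)]
    by (metis inf_assoc inf_commute inf.absorb_iff2 openin_open)
  then have "openin (top_of_set (\<phi> ` U)) (\<phi> ` (U \<inter> T))"
    by (rule homeomorphism_imp_open_map[OF \<phi>(3)])
  then have "open (\<psi> ` W)" unfolding \<psi>W using \<phi>(2) openin_open_trans by blast
  moreover have "homeomorphism W (\<psi> ` W) \<psi> (r \<circ> \<phi>')"
    unfolding \<psi>W unfolding \<psi>_def using homeomorphism_compose[OF hp h\<phi>] .
  ultimately have "is_chart Mt (W, \<psi>)" using W_open by (auto simp: is_chart_def)
  moreover have "locally_affinely_related Mt (W \<inter> p -` U2) \<psi> (\<phi>2 \<circ> p)" if U2: "(U2, \<phi>2) \<in> \<A>" for U2 \<phi>2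
    unfolding locally_affinely_related_def
  proof
    fix x assume x: "x \<in> W \<inter> p -` U2"
    have "affinely_compatible M (U2, \<phi>2) (U, \<phi>)" using flat U U2 unfolding flat_affine_structure_def by blast
    then have "locally_affinely_related M (U2 \<inter> U) \<phi> \<phi>2" by (simp add: affinely_compatible_def)
    moreover have "p x \<in> U2 \<inter> U" using x by (auto simp: W_def)
    ultimately obtain g N where gN: "g \<in> Aff2" "openin (top_of_set M) N" "p x \<in> N" "N \<subseteq> U2 \<inter> U"
      "\<forall>y\<in>N. \<phi> y = g (\<phi>2 y)"
      unfolding locally_affinely_related_def by blast
    show "\<exists>g\<in>Aff2. \<exists>N. openin (top_of_set Mt) N \<and> x \<in> N \<and> N \<subseteq> W \<inter> p -` U2 \<and>
        (\<forall>y\<in>N. \<psi> y = g ((\<phi>2 \<circ> p) y))"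
    proof (intro bexI[of _ g] exI[of _ "W \<inter> (Mt \<inter> p -` N)"] conjI gN(1))
      show "openin (top_of_set Mt) (W \<inter> (Mt \<inter> p -` N))"
        by (intro openin_Int W_open continuous_openin_preimage[OF cont _ gN(2)]) (use im in auto)
    qed (use gN x in \<open>auto simp: W_def \<psi>_def\<close>)
  qed
  ultimately have "(W, \<psi>) \<in> inherited_structure Mt p \<A>" by (auto simp: inherited_structure_def)
  then have "locally_affinely_related Mt W D \<psi>" using dev unfolding development_map_def by blast
  then obtain g N where gN: "g \<in> Aff2" "openin (top_of_set Mt) N" "m \<in> N" "N \<subseteq> W"
    "\<forall>y\<in>N. D y = g (\<psi> y)"
    unfolding locally_affinely_related_def using mW by blast
  show thesis
  proof (rule that[OF gN(1) U(1) gN(2,3)])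
    show "N \<subseteq> Mt \<inter> p -` U" using gN(4) by (auto simp: W_def)
    show "inj_on p N" using hp gN(4) by (metis homeomorphism_apply1 inj_on_inverseI inj_on_subset)
    show "D y = g (\<phi> (p y))" if "y \<in> N" for y using gN(5) that by (simp add: \<psi>_def)
  qed
qed

lemma Aff2I: "invertible L \<Longrightarrow> (\<lambda>x. L *v x + b) \<in> Aff2"
  by (auto simp: Aff2_def)

lemma Aff2_continuous:
  assumes "g \<in> Aff2"
  shows "continuous_on S g"
proof -
  obtain L b where "g = (\<lambda>x. L *v x + b)" using assms by (auto simp: Aff2_def)
  then show ?thesis by (auto intro!: continuous_intros matrix_vector_mult_linear_continuous_on)
qed

lemma Aff2_comp:
  assumes "g \<in> Aff2" "h \<in> Aff2"
  shows "g \<circ> h \<in> Aff2"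
proof -
  obtain L b L' b' where L: "invertible L" "g = (\<lambda>x. L *v x + b)" "invertible L'" "h = (\<lambda>x. L' *v x + b')"
    using assms by (auto simp: Aff2_def)
  have "g \<circ> h = (\<lambda>x. (L ** L') *v x + (L *v b' + b))"
    by (simp add: L fun_eq_iff matrix_vector_right_distrib matrix_vector_mul_assoc)
  then show ?thesis using Aff2I[OF invertible_mult[OF L(1,3)]] by simp
qed

lemma Aff2_inverse:
  assumes "g \<in> Aff2"
  obtains h where "h \<in> Aff2" "\<And>x. h (g x) = x"
proof -
  obtain L b where L: "invertible L" "g = (\<lambda>x. L *v x + b)" using assms by (auto simp: Aff2_def)
  then obtain L' where L': "L ** L' = mat 1" "L' ** L = mat 1" by (auto simp: invertible_def)
  then have "invertible L'" by (auto simp: invertible_def)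
  then have "(\<lambda>x. L' *v x + - (L' *v b)) \<in> Aff2" by (rule Aff2I)
  moreover have "L' *v g x + - (L' *v b) = x" for x
    by (simp add: L matrix_vector_right_distrib matrix_vector_mul_assoc L')
  ultimately show thesis using that by blast
qed

lemma Aff2_inj: "g \<in> Aff2 \<Longrightarrow> inj g"
  by (metis Aff2_inverse injI)

lemma development_map_unramified:
  assumes flat: "flat_affine_structure M \<A>" and cov: "covering_space Mt p M"
    and dev: "development_map Mt (inherited_structure Mt p \<A>) D" and m: "m \<in> Mt"
  obtains N where "openin (top_of_set Mt) N" "m \<in> N" "inj_on D N" "continuous_on N D"
proof -
  obtain g U \<phi> N where N: "g \<in> Aff2" "(U, \<phi>) \<in> \<A>" "openin (top_of_set Mt) N" "m \<in> N"
    "N \<subseteq> Mt \<inter> p -` U" "inj_on p N" "\<And>y. y \<in> N \<Longrightarrow> D y = g (\<phi> (p y))"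
    using development_map_local[OF assms] by metis
  have "is_chart M (U, \<phi>)" using flat N(2) unfolding flat_affine_structure_def by blast
  then obtain \<phi>' where \<phi>: "homeomorphism U (\<phi> ` U) \<phi> \<phi>'" by (auto simp: is_chart_def)
  have "inj_on \<phi> U" by (rule inj_on_inverseI[of _ \<phi>']) (rule homeomorphism_apply1[OF \<phi>])
  then have "inj_on D N"
    using N(5-7) Aff2_inj[OF N(1)] by (smt (verit) IntD2 injD inj_onD inj_onI subsetD vimageD)
  moreover have "continuous_on N D"
  proof (rule continuous_on_eq)
    show "continuous_on N (\<lambda>y. g (\<phi> (p y)))"
      by (rule continuous_on_compose2[OF Aff2_continuous[OF N(1), of UNIV]],
          rule continuous_on_compose2[OF homeomorphism_cont1[OF \<phi>]],
          rule continuous_on_subset[OF covering_space_imp_continuous[OF cov]])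
         (use N(5) in auto)
  qed (simp add: N(7))
  ultimately show thesis using that N by blast
qed

lemma development_map_holonomy_local:
  fixes u :: "complex \<Rightarrow> 'b::topological_space"
  assumes flat: "flat_affine_structure M \<A>" and cov: "covering_space Mt p M"
    and dev: "development_map Mt (inherited_structure Mt p \<A>) D"
    and u: "continuous_on UNIV u" "range u \<subseteq> Mt" and period: "\<And>z. p (u (z + \<gamma>)) = p (u z)"
  shows "\<exists>g\<in>Aff2. \<exists>N. open N \<and> z \<in> N \<and> (\<forall>y\<in>N. D (u (y + \<gamma>)) = g (D (u y)))"
proof -
  have pcont: "continuous_on Mt p" and im: "p ` Mt = M" using cov by (auto simp: covering_space_def)
  obtain g1 U1 \<phi>1 N1 where N1: "g1 \<in> Aff2" "(U1, \<phi>1) \<in> \<A>" "openin (top_of_set Mt) N1" "u z \<in> N1"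
    "N1 \<subseteq> Mt \<inter> p -` U1" "inj_on p N1" "\<And>y. y \<in> N1 \<Longrightarrow> D y = g1 (\<phi>1 (p y))"
    by (rule development_map_local[OF flat cov dev, of "u z"]) (use u in blast, rule that)
  obtain g2 U2 \<phi>2 N2 where N2: "g2 \<in> Aff2" "(U2, \<phi>2) \<in> \<A>" "openin (top_of_set Mt) N2" "u (z + \<gamma>) \<in> N2"
    "N2 \<subseteq> Mt \<inter> p -` U2" "inj_on p N2" "\<And>y. y \<in> N2 \<Longrightarrow> D y = g2 (\<phi>2 (p y))"
    by (rule development_map_local[OF flat cov dev, of "u (z + \<gamma>)"]) (use u in blast, rule that)
  have "affinely_compatible M (U1, \<phi>1) (U2, \<phi>2)"
    using flat N1(2) N2(2) unfolding flat_affine_structure_def by blast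
  then have "locally_affinely_related M (U1 \<inter> U2) \<phi>2 \<phi>1" by (simp add: affinely_compatible_def)
  moreover have "p (u z) \<in> U1 \<inter> U2" using N1(4,5) N2(4,5) period by auto
  ultimately obtain g N0 where N0: "g \<in> Aff2" "openin (top_of_set M) N0" "p (u z) \<in> N0"
    "\<forall>x\<in>N0. \<phi>2 x = g (\<phi>1 x)"
    unfolding locally_affinely_related_def by blast
  obtain g1' where g1': "g1' \<in> Aff2" "\<And>x. g1' (g1 x) = x" by (rule Aff2_inverse[OF N1(1)]) (rule that)
  define N where "N = (UNIV \<inter> u -` N1) \<inter> (UNIV \<inter> (\<lambda>y. u (y + \<gamma>)) -` N2) \<inter> (UNIV \<inter> (\<lambda>y. p (u y)) -` N0)"
  have "openin (top_of_set UNIV) (UNIV \<inter> u -` N1)"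
    by (rule continuous_openin_preimage[OF u(1) _ N1(3)]) (use u in auto)
  moreover have "openin (top_of_set UNIV) (UNIV \<inter> (\<lambda>y. u (y + \<gamma>)) -` N2)"
    by (rule continuous_openin_preimage[OF continuous_on_compose2[OF u(1)] _ N2(3)])
       (use u in \<open>auto intro!: continuous_intros\<close>)
  moreover have "openin (top_of_set UNIV) (UNIV \<inter> (\<lambda>y. p (u y)) -` N0)"
    by (rule continuous_openin_preimage[OF continuous_on_compose2[OF pcont u(1)] _ N0(2)])
       (use u im in auto)
  ultimately have "openin (top_of_set UNIV) N" unfolding N_def by (intro openin_Int[OF openin_Int])
  moreover have "z \<in> N" using N0 N1 N2 by (auto simp: N_def)
  moreover have "D (u (y + \<gamma>)) = (g2 \<circ> (g \<circ> g1')) (D (u y))" if "y \<in> N" for y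
    using that N1(7) N2(7) N0(4) g1' period by (simp add: N_def)
  moreover have "g2 \<circ> (g \<circ> g1') \<in> Aff2" using N0(1) N2(1) g1'(1) by (intro Aff2_comp)
  ultimately show ?thesis by (metis openin_subtopology_self open_openin subtopology_UNIV)
qed

section \<open>Equivariant immersions of the plane\<close>

locale plane_immersion =
  fixes f :: "complex \<Rightarrow> complex"
  assumes cont: "continuous_on UNIV f"
    and loc_inj: "\<And>z. \<exists>N. open N \<and> z \<in> N \<and> inj_on f N"
begin

sublocale unramified UNIV f
  by (rule unramified_t2I) (use cont loc_inj in auto)

lemma local_inverse:
  obtains N s where "open N" "z \<in> N" "homeomorphism N (f ` N) f s" "open (f ` N)"
proof -
  obtain N where N: "open N" "z \<in> N" "inj_on f N" using loc_inj by blast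
  have cN: "continuous_on N f" using cont continuous_on_subset by blast
  obtain s where "homeomorphism N (f ` N) f s"
    using invariance_of_domain_homeomorphism[OF N(1) cN _ N(3)] by auto
  moreover have "open (f ` N)" using invariance_of_domain[OF cN N(1) N(3)] .
  ultimately show thesis using that N by blast
qed

lemma open_map:
  assumes "open V"
  shows "open (f ` V)"
proof (subst open_subopen, clarify)
  fix z assume z: "z \<in> V"
  obtain N where N: "open N" "z \<in> N" "inj_on f N" using loc_inj by blast
  have "open (f ` (N \<inter> V))"
    using cont N assms by (intro invariance_of_domain open_Int) (auto intro: continuous_on_subset inj_on_subset)
  then show "\<exists>T. open T \<and> f z \<in> T \<and> T \<subseteq> f ` V"
    using N z by (intro exI[of _ "f ` (N \<inter> V)"]) auto
qed

lemma flow_lift_local: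
  fixes E :: "real \<Rightarrow> complex \<Rightarrow> complex"
  assumes E0: "\<And>w. E 0 w = w" and E_cont: "continuous_on UNIV (\<lambda>(t, w). E t w)"
  shows "\<exists>\<delta> N \<psi>. \<delta> > 0 \<and> open N \<and> z \<in> N \<and> continuous_on (ball 0 \<delta> \<times> N) \<psi> \<and>
    (\<forall>t\<in>ball 0 \<delta>. \<forall>y\<in>N. f (\<psi> (t, y)) = E t (f y)) \<and> (\<forall>y\<in>N. \<psi> (0, y) = y)"
proof -
  obtain N0 s where N0: "open N0" "z \<in> N0" "homeomorphism N0 (f ` N0) f s" "open (f ` N0)"
    by (rule local_inverse)
  define P where "P = (\<lambda>(t, w). E t w) -` (f ` N0)"
  have "open P" unfolding P_def using continuous_open_vimage E_cont N0(4)
    by (metis continuous_on_open_vimage open_UNIV inf_top.right_neutral)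
  moreover have "(0, f z) \<in> P" using N0(2) by (simp add: P_def E0)
  ultimately obtain A B where AB: "open A" "open B" "0 \<in> A" "f z \<in> B" "A \<times> B \<subseteq> P"
    by (metis open_prod_elim mem_Sigma_iff)
  obtain \<delta> where \<delta>: "\<delta> > 0" "ball 0 \<delta> \<subseteq> A" using AB(1,3) open_contains_ball by blast
  define N where "N = N0 \<inter> f -` B"
  have "open N" unfolding N_def using N0(1) cont AB(2)
    by (metis continuous_on_open_vimage open_UNIV inf_top.right_neutral open_Int)
  moreover have "z \<in> N" using N0 AB by (simp add: N_def)
  moreover have in_img: "E t (f y) \<in> f ` N0" if "t \<in> ball 0 \<delta>" "y \<in> N" for t y
  proof -
    have "(t, f y) \<in> P" using that AB(5) \<delta>(2) by (auto simp: N_def)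
    then show ?thesis by (simp add: P_def)
  qed
  moreover have "continuous_on (ball 0 \<delta> \<times> N) (\<lambda>x. E (fst x) (f (snd x)))"
    using continuous_on_compose2[OF E_cont[unfolded case_prod_beta], of "ball 0 \<delta> \<times> N" "\<lambda>x. (fst x, f (snd x))"]
    by (force intro!: continuous_intros continuous_on_compose2[OF cont])
  then have "continuous_on (ball 0 \<delta> \<times> N) (\<lambda>x. s (E (fst x) (f (snd x))))"
    by (rule continuous_on_compose2[OF homeomorphism_cont2[OF N0(3)]]) (use in_img in auto)
  ultimately show ?thesis
    using \<delta>(1) homeomorphism_apply2[OF N0(3)] homeomorphism_apply1[OF N0(3)]
    by (intro exI[of _ \<delta>] exI[of _ N] exI[of _ "\<lambda>x. s (E (fst x) (f (snd x)))"])
       (auto simp: E0 N_def)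
qed

text \<open>By equivariance the local lifts of a flow over the compact fundamental square give lifts of uniform
  duration everywhere; a flow on the torus is complete.\<close>

lemma flow_lift:
  fixes E :: "real \<Rightarrow> complex \<Rightarrow> complex"
  assumes E0: "\<And>w. E 0 w = w" and Eadd: "\<And>s t w. E (s + t) w = E s (E t w)"
    and E_cont: "continuous_on UNIV (\<lambda>(t, w). E t w)"
    and equiv: "\<And>\<gamma>. torus_exp \<gamma> = torus_exp 0 \<Longrightarrow>
      \<exists>g. (\<forall>z. f (z + \<gamma>) = g (f z)) \<and> (\<forall>t w. E t (g w) = g (E t w))"
  shows "\<exists>\<Psi>. continuous_on (ball 0 T \<times> UNIV) \<Psi> \<and>
    (\<forall>t\<in>ball 0 T. \<forall>z. f (\<Psi> (t, z)) = E t (f z)) \<and> (\<forall>z. \<Psi> (0, z) = z)"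
proof -
  define P where "P \<delta> N \<psi> \<longleftrightarrow> open N \<and> continuous_on (ball 0 \<delta> \<times> N) \<psi> \<and>
    (\<forall>t\<in>ball 0 \<delta>. \<forall>y\<in>N. f (\<psi> (t, y)) = E t (f y)) \<and> (\<forall>y\<in>N. \<psi> (0, y) = y)" for \<delta> N \<psi>
  have "\<exists>\<delta> N \<psi>. \<delta> > 0 \<and> z \<in> N \<and> P \<delta> N \<psi>" for z
    using flow_lift_local[OF E0 E_cont, of z] unfolding P_def by blast
  then obtain d N \<psi> where d: "\<And>z. d z > 0" and N: "\<And>z. z \<in> N z" and P: "\<And>z. P (d z) (N z) (\<psi> z)"
    by metis
  define K where "K = cbox 0 (Complex (2 * pi) (2 * pi))"
  have "compact K" "\<And>z. open (N z)" using P by (auto simp: K_def P_def)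
  then obtain D where D: "D \<subseteq> K" "finite D" "K \<subseteq> (\<Union>z\<in>D. N z)"
    using compactE_image[of K K N] N by (metis UN_I subsetI)
  have "0 \<in> K" by (simp add: K_def in_cbox_complex_iff)
  then have "D \<noteq> {}" using D(3) by auto
  define \<delta> where "\<delta> = Min (d ` D)"
  have \<delta>: "\<delta> > 0" "\<And>z. z \<in> D \<Longrightarrow> \<delta> \<le> d z" using D(2) \<open>D \<noteq> {}\<close> d by (auto simp: \<delta>_def)
  have "\<exists>M \<psi>'. openin (top_of_set UNIV) M \<and> x \<in> M \<and>
      continuous_on (ball 0 \<delta> \<times> M) \<psi>' \<and> \<psi>' \<in> ball 0 \<delta> \<times> M \<rightarrow> UNIV \<and>
      (\<forall>t\<in>ball 0 \<delta>. \<forall>y\<in>M. f (\<psi>' (t, y)) = E t (f y)) \<and> (\<forall>y\<in>M. \<psi>' (0, y) = y)" for x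
  proof -
    define \<gamma> where "\<gamma> = Complex (2 * pi * of_int \<lfloor>Re x / (2 * pi)\<rfloor>) (2 * pi * of_int \<lfloor>Im x / (2 * pi)\<rfloor>)"
    have "torus_exp \<gamma> = torus_exp 0" by (simp add: torus_exp_def \<gamma>_def cis_multiple_2pi)
    then obtain g where g: "\<And>z. f (z + \<gamma>) = g (f z)" "\<And>t w. E t (g w) = g (E t w)"
      using equiv by metis
    have fl: "0 \<le> r - 2 * pi * of_int \<lfloor>r / (2 * pi)\<rfloor> \<and> r - 2 * pi * of_int \<lfloor>r / (2 * pi)\<rfloor> \<le> 2 * pi" for r
      using floor_divide_lower[of "2 * pi" r] floor_divide_upper[of "2 * pi" r]
      by (simp add: algebra_simps)
    have "x - \<gamma> \<in> K" using fl[of "Re x"] fl[of "Im x"] by (simp add: K_def in_cbox_complex_iff \<gamma>_def)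
    then obtain z where z: "z \<in> D" "x - \<gamma> \<in> N z" using D(3) by blast
    have Pz: "open (N z)" "continuous_on (ball 0 (d z) \<times> N z) (\<psi> z)"
      "\<And>t y. t \<in> ball 0 (d z) \<Longrightarrow> y \<in> N z \<Longrightarrow> f (\<psi> z (t, y)) = E t (f y)" "\<And>y. y \<in> N z \<Longrightarrow> \<psi> z (0, y) = y"
      using P[of z] unfolding P_def by blast+
    define M where "M = (\<lambda>y. y - \<gamma>) -` N z"
    have "open M" unfolding M_def
      by (intro open_vimage Pz(1)) (intro continuous_intros)
    moreover have "continuous_on (ball 0 \<delta> \<times> M) (\<lambda>w. \<psi> z (fst w, snd w - \<gamma>) + \<gamma>)"
      using \<delta>(2)[OF z(1)]
      by (intro continuous_intros continuous_on_compose2[OF Pz(2)]) (auto simp: M_def intro!: continuous_intros)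
    moreover have "f (\<psi> z (t, y - \<gamma>) + \<gamma>) = E t (f y)" if "t \<in> ball 0 \<delta>" "y \<in> M" for t y
    proof -
      have "f (\<psi> z (t, y - \<gamma>)) = E t (f (y - \<gamma>))"
        using that \<delta>(2)[OF z(1)] by (intro Pz(3)) (auto simp: M_def)
      then have "f (\<psi> z (t, y - \<gamma>) + \<gamma>) = E t (f (y - \<gamma> + \<gamma>))" unfolding g(1) by (simp add: g(2))
      then show ?thesis by simp
    qed
    moreover have "\<psi> z (0, y - \<gamma>) + \<gamma> = y" if "y \<in> M" for y using Pz(4) that by (simp add: M_def)
    moreover have "x \<in> M" using z by (simp add: M_def)
    ultimately show ?thesis
      by (intro exI[of _ M] exI[of _ "\<lambda>w. \<psi> z (fst w, snd w - \<gamma>) + \<gamma>"]) auto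
  qed
  then have "\<exists>\<Psi>. continuous_on (ball 0 T \<times> UNIV) \<Psi> \<and> \<Psi> \<in> ball 0 T \<times> UNIV \<rightarrow> UNIV \<and>
    (\<forall>v\<in>ball 0 T. \<forall>y\<in>UNIV. f (\<Psi> (v, y)) = E v (f y)) \<and> (\<forall>y\<in>UNIV. \<Psi> (0, y) = y)"
    by (intro action_lift[OF E0 Eadd \<delta>(1)])
  then show ?thesis by auto
qed

end

lemma no_locally_injective_closed_function:
  fixes h :: "real \<Rightarrow> real"
  assumes ab: "a < b" and cont: "continuous_on {a..b} h" and eq: "h a = h b"
    and inj: "\<And>s. s \<in> {a<..<b} \<Longrightarrow> \<exists>e>0. inj_on h ({s - e<..<s + e} \<inter> {a..b})"
  shows False
proof -
  have no_ext: False
    if s: "s \<in> {a<..<b}" and ext: "(\<forall>t\<in>{a..b}. h t \<le> h s) \<or> (\<forall>t\<in>{a..b}. h s \<le> h t)" for s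
  proof -
    obtain e where e: "e > 0" "inj_on h ({s - e<..<s + e} \<inter> {a..b})" using inj s by blast
    define d where "d = min (e / 2) (min (s - a) (b - s))"
    have d: "d > 0" "d < e" "a \<le> s - d" "s + d \<le> b" using e s by (auto simp: d_def min_def)
    have "inj_on h {s - d..s + d}" by (rule inj_on_subset[OF e(2)]) (use d in auto)
    moreover have "continuous_on {s - d..s + d} h" by (rule continuous_on_subset[OF cont]) (use d in auto)
    ultimately have "(h (s - d) < h s \<and> h s < h (s + d)) \<or> (h (s + d) < h s \<and> h s < h (s - d))"
      using continuous_inj_imp_mono[of "s - d" s "s + d" h] d(1) by auto
    moreover have "s - d \<in> {a..b}" "s + d \<in> {a..b}" using d by auto
    ultimately show False using ext by (meson not_less)
  qed
  obtain u where u: "u \<in> {a..b}" "\<And>t. t \<in> {a..b} \<Longrightarrow> h t \<le> h u"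
    using continuous_attains_sup[OF compact_Icc _ cont] ab by auto
  obtain l where l: "l \<in> {a..b}" "\<And>t. t \<in> {a..b} \<Longrightarrow> h l \<le> h t"
    using continuous_attains_inf[OF compact_Icc _ cont] ab by auto
  show False
  proof (cases "u \<in> {a<..<b} \<or> l \<in> {a<..<b}")
    case True
    then show False using no_ext[of u] no_ext[of l] u(2) l(2) by metis
  next
    case False
    then have "h u = h a" "h l = h a" using u(1) l(1) eq by (auto simp: less_le)
    then have const: "h t = h a" if "t \<in> {a..b}" for t using u(2)[OF that] l(2)[OF that] by simp
    have m: "(a + b) / 2 \<in> {a<..<b}" using ab by simp
    then have "h ((a + b) / 2) = h a" by (intro const) auto
    then have "\<forall>t\<in>{a..b}. h t \<le> h ((a + b) / 2)" using const by (metis order_refl)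
    then show False using no_ext[OF m] by blast
  qed
qed

context plane_immersion
begin

text \<open>A path between two points with the same image is pushed along the lifted horizontal flow into a
  level set of \<open>Re \<circ> f\<close>, on which \<open>Im \<circ> f\<close> is locally injective.\<close>

lemma inj_if_horizontal_flow:
  assumes flow: "\<And>T. \<exists>\<Psi>. continuous_on (ball 0 T \<times> UNIV) \<Psi> \<and>
    (\<forall>t\<in>ball 0 T. \<forall>z. f (\<Psi> (t, z)) = f z + of_real t) \<and> (\<forall>z. \<Psi> (0, z) = z)"
  shows "inj f"
proof (rule injI, rule ccontr)
  fix p q assume pq: "f p = f q" "p \<noteq> q"
  define \<rho> where "\<rho> s = Re (f p) - Re (f (linepath p q s))" for s
  have "continuous_on {0..1} \<rho>" unfolding \<rho>_def
    by (intro continuous_intros continuous_on_compose2[OF cont]) auto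
  then have "bounded (\<rho> ` {0..1})" by (intro compact_imp_bounded compact_continuous_image) auto
  then obtain T where "\<forall>x\<in>\<rho> ` {0..1}. norm x < T" unfolding bounded_pos_less by blast
  then have T: "\<rho> s \<in> ball 0 T" if "s \<in> {0..1}" for s using that by simp
  obtain \<Psi> where \<Psi>: "continuous_on (ball 0 T \<times> UNIV) \<Psi>"
    "\<And>t z. t \<in> ball 0 T \<Longrightarrow> f (\<Psi> (t, z)) = f z + of_real t" "\<And>z. \<Psi> (0, z) = z"
    using flow[of T] by metis
  define c where "c s = \<Psi> (\<rho> s, linepath p q s)" for s
  have "path c" unfolding path_def c_def
    by (rule continuous_on_compose2[OF \<Psi>(1)])
       (use T \<open>continuous_on {0..1} \<rho>\<close> in \<open>auto intro!: continuous_intros\<close>)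
  moreover have "pathstart c = p" "pathfinish c = q"
    using \<Psi>(3) pq(1) by (auto simp: pathstart_def pathfinish_def c_def \<rho>_def linepath_0' linepath_1')
  ultimately obtain a where a: "arc a" "path_image a \<subseteq> path_image c" "pathstart a = p" "pathfinish a = q"
    using path_contains_arc[of c p q] pq(2) by metis
  have "Re (f (c s)) = Re (f p)" if "s \<in> {0..1}" for s
    using \<Psi>(2)[OF T[OF that]] by (simp add: c_def \<rho>_def)
  then have Re_a: "Re (f (a s)) = Re (f p)" if "s \<in> {0..1}" for s
    using a(2) that by (force simp: path_image_def)
  have a_cont: "continuous_on {0..1} a" and a_inj: "inj_on a {0..1}"
    using a(1) by (auto simp: arc_def path_def)
  show False
  proof (rule no_locally_injective_closed_function[of 0 1 "\<lambda>s. Im (f (a s))"])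
    show "continuous_on {0..1} (\<lambda>s. Im (f (a s)))"
      by (intro continuous_intros continuous_on_compose2[OF cont a_cont]) auto
    show "Im (f (a 0)) = Im (f (a 1))" using a(3,4) pq(1) by (simp add: pathstart_def pathfinish_def)
    fix s :: real assume s: "s \<in> {0<..<1}"
    obtain N where N: "open N" "a s \<in> N" "inj_on f N" using loc_inj by blast
    have "openin (top_of_set {0..1}) ({0..1} \<inter> a -` N)"
      using a_cont N(1) by (simp add: continuous_openin_preimage_gen)
    moreover have "s \<in> {0..1} \<inter> a -` N" using s N by auto
    ultimately obtain e where e: "e > 0" "ball s e \<inter> {0..1} \<subseteq> {0..1} \<inter> a -` N"
      unfolding openin_contains_ball by blast
    have "inj_on (\<lambda>s. Im (f (a s))) (ball s e \<inter> {0..1})"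
    proof (rule inj_onI)
      fix x y assume xy: "x \<in> ball s e \<inter> {0..1}" "y \<in> ball s e \<inter> {0..1}" "Im (f (a x)) = Im (f (a y))"
      then have "f (a x) = f (a y)" using Re_a by (simp add: complex_eq_iff)
      moreover have "a x \<in> N" "a y \<in> N" using e(2) xy by auto
      ultimately have "a x = a y" using N(3) by (meson inj_onD)
      then show "x = y" using a_inj xy by (meson IntD2 inj_onD)
    qed
    moreover have "ball s e = {s - e<..<s + e}" by (auto simp: dist_real_def)
    ultimately show "\<exists>e>0. inj_on (\<lambda>s. Im (f (a s))) ({s - e<..<s + e} \<inter> {0..1})" using e(1) by auto
  qed auto
qed

lemma covering_space_if_inj:
  assumes "inj f"
  shows "covering_space UNIV f (range f)"
proof -
  obtain s where "homeomorphism UNIV (range f) f s"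
    using invariance_of_domain_homeomorphism[OF open_UNIV cont _ assms] by auto
  then show ?thesis by (rule homeomorphism_imp_covering_space)
qed

text \<open>The expanding flow carries a local inverse at a zero of \<open>f\<close> to inverses on arbitrarily large discs.\<close>

lemma inj_if_euler_flow_zero:
  assumes flow: "\<And>T. \<exists>\<Psi>. continuous_on (ball 0 T \<times> UNIV) \<Psi> \<and>
    (\<forall>t\<in>ball 0 T. \<forall>z. f (\<Psi> (t, z)) = exp t *\<^sub>R f z) \<and> (\<forall>z. \<Psi> (0, z) = z)"
    and zero: "f z0 = 0"
  shows "inj f"
proof (rule injI)
  fix p q assume pq: "f p = f q"
  obtain N s where N: "open N" "z0 \<in> N" "homeomorphism N (f ` N) f s" "open (f ` N)"
    by (rule local_inverse)
  have "0 \<in> f ` N" using N(2) zero by force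
  then obtain r where r: "r > 0" "ball 0 r \<subseteq> f ` N" using N(4) open_contains_ball by blast
  define B where "B = cball z0 (max (dist z0 p) (dist z0 q))"
  have B: "z0 \<in> B" "p \<in> B" "q \<in> B" "connected B"
    by (auto simp: B_def intro: order_trans[OF zero_le_dist max.cobounded1])
  have "bounded (f ` B)" unfolding B_def
    by (intro compact_imp_bounded compact_continuous_image continuous_on_subset[OF cont]) auto
  then obtain R where R0: "R > 0" "\<forall>x\<in>f ` B. norm x < R" unfolding bounded_pos_less by blast
  then have R: "R > 0" "\<And>z. z \<in> B \<Longrightarrow> norm (f z) < R" by auto
  define T where "T = max 1 (ln (R / r))"
  have T: "T > 0" "R \<le> exp T * r"
  proof -
    have "R / r = exp (ln (R / r))" using R r by simp
    also have "\<dots> \<le> exp T" by (simp add: T_def)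
    finally show "R \<le> exp T * r" using r by (simp add: field_simps)
  qed (simp add: T_def)
  obtain \<Psi> where \<Psi>: "continuous_on (ball 0 (T + 1) \<times> UNIV) \<Psi>"
    "\<And>t z. t \<in> ball 0 (T + 1) \<Longrightarrow> f (\<Psi> (t, z)) = exp t *\<^sub>R f z" "\<And>z. \<Psi> (0, z) = z"
    using flow[of "T + 1"] by metis
  have T_ball: "T \<in> ball 0 (T + 1)" using T by simp
  define S where "S w = \<Psi> (T, s (exp (- T) *\<^sub>R w))" for w
  have small: "exp (- T) *\<^sub>R f z \<in> ball 0 r" if "z \<in> B" for z
  proof -
    have "norm (f z) < exp T * r" using R(2)[OF that] T(2) by linarith
    then show ?thesis by (simp add: exp_minus field_simps)
  qed
  have fixed: "\<Psi> (T, z0) = z0"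
  proof (rule lift_unique[of "{0..T}" "\<lambda>t. \<Psi> (t, z0)" "\<lambda>_. z0" 0])
    show "continuous_on {0..T} (\<lambda>t. \<Psi> (t, z0))"
      by (rule continuous_on_compose2[OF \<Psi>(1)]) (auto intro!: continuous_intros)
  qed (use T \<Psi>(2,3) zero in auto)
  have "S (f z) = z" if "z \<in> B" for z
  proof (rule lift_unique[of B "\<lambda>z. S (f z)" "\<lambda>z. z" z0])
    have "continuous_on B (\<lambda>z. s (exp (- T) *\<^sub>R f z))"
      by (rule continuous_on_compose2[OF homeomorphism_cont2[OF N(3)]])
         (use small r(2) in \<open>auto intro!: continuous_intros continuous_on_subset[OF cont] simp del: mem_ball\<close>)
    then show "continuous_on B (\<lambda>z. S (f z))" unfolding S_def
      by (intro continuous_on_compose2[OF \<Psi>(1)]) (use T_ball in \<open>auto intro!: continuous_intros\<close>)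
    show "f (S (f z)) = f z" if "z \<in> B" for z
    proof -
      have "f (s (exp (- T) *\<^sub>R f z)) = exp (- T) *\<^sub>R f z"
        using small[OF that] r(2) homeomorphism_apply2[OF N(3)] by blast
      then show ?thesis unfolding S_def \<Psi>(2)[OF T_ball] by (simp add: exp_minus)
    qed
    show "S (f z0) = z0"
      using homeomorphism_apply1[OF N(3) N(2)] fixed zero by (simp add: S_def)
  qed (use B that in auto)
  then show "p = q" using B pq by metis
qed

end

section \<open>Logarithms of equivariant immersions\<close>

interpretation complex_exp: unramified UNIV "exp :: complex \<Rightarrow> complex"
  by (rule covering_space_imp_unramified[OF covering_space_exp_punctured_plane])

lemma period_uminus: "torus_exp \<gamma> = torus_exp 0 \<Longrightarrow> torus_exp (- \<gamma>) = torus_exp 0"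
  by (simp add: torus_exp_def complex_eq_iff)

lemma period_add:
  "torus_exp \<gamma> = torus_exp 0 \<Longrightarrow> torus_exp \<delta> = torus_exp 0 \<Longrightarrow> torus_exp (\<gamma> + \<delta>) = torus_exp 0"
  by (simp add: torus_exp_add)

text \<open>\<open>F\<close> is a logarithm of the development map; its image is a horizontal strip.\<close>

locale log_development =
  fixes F :: "complex \<Rightarrow> complex"
  assumes F_cont: "continuous_on UNIV F" and F_inj: "inj F"
    and horizontal: "\<And>z t. F z + of_real t \<in> range F"
    and equivariant: "\<And>\<gamma>. torus_exp \<gamma> = torus_exp 0 \<Longrightarrow>
      \<exists>A. linear A \<and> inj A \<and> (\<forall>z. exp (F (z + \<gamma>)) = A (exp (F z)))"
begin

definition heights :: "real set" where "heights = Im ` range F"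

definition translation :: "complex \<Rightarrow> complex \<Rightarrow> complex" where
  "translation \<gamma> w = F (inv F w + \<gamma>)"

definition height_map :: "complex \<Rightarrow> real \<Rightarrow> real" where
  "height_map \<gamma> \<theta> = Im (translation \<gamma> (\<i> * of_real \<theta>))"

lemma inv_F [simp]: "inv F (F z) = z"
  using F_inj by simp

lemma F_inv: "w \<in> range F \<Longrightarrow> F (inv F w) = w"
  by (simp add: f_inv_into_f)

lemma range_iff: "w \<in> range F \<longleftrightarrow> Im w \<in> heights"
proof
  assume "Im w \<in> heights"
  then obtain z where "Im (F z) = Im w" by (auto simp: heights_def)
  then have "w = F z + of_real (Re w - Re (F z))" by (simp add: complex_eq_iff)
  then show "w \<in> range F" using horizontal by metis
qed (simp add: heights_def)

lemma homeo: "homeomorphism UNIV (range F) F (inv F)"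
proof -
  obtain g where g: "homeomorphism UNIV (range F) F g"
    using invariance_of_domain_homeomorphism[OF open_UNIV F_cont _ F_inj] by auto
  have "inv F w = g w" if "w \<in> range F" for w
    using that homeomorphism_apply1[OF g] by auto
  then show ?thesis using homeomorphism_cong[OF g] by auto
qed

lemma open_heights: "open heights"
proof -
  have "open (range F)" using invariance_of_domain[OF F_cont open_UNIV F_inj] .
  then have "open ((\<lambda>\<theta>. \<i> * of_real \<theta>) -` range F)"
    by (intro open_vimage) (auto intro!: continuous_intros)
  also have "(\<lambda>\<theta>. \<i> * of_real \<theta>) -` range F = heights"
    by (intro set_eqI) (simp add: range_iff vimage_def del: rangeI)
  finally show ?thesis .
qed

lemma interval_heights: "is_interval heights"
  unfolding heights_def is_interval_connected_1
  by (intro connected_continuous_image F_cont) (auto intro!: continuous_intros)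

lemma translation_in_range: "translation \<gamma> w \<in> range F"
  by (simp add: translation_def)

lemma translation_add: "translation \<gamma> (translation \<delta> w) = translation (\<gamma> + \<delta>) w"
  by (simp add: translation_def add_ac)

lemma translation_0: "w \<in> range F \<Longrightarrow> translation 0 w = w"
  by (simp add: translation_def F_inv)

lemma translation_cont: "continuous_on (range F) (translation \<gamma>)"
  unfolding translation_def
  by (intro continuous_on_compose2[OF F_cont] continuous_intros homeomorphism_cont2[OF homeo]) auto

lemma exp_translation:
  assumes "torus_exp \<gamma> = torus_exp 0"
  obtains A where "linear A" "inj A" "\<And>w. w \<in> range F \<Longrightarrow> exp (translation \<gamma> w) = A (exp w)"
proof -
  obtain A where "linear A" "inj A" "\<And>z. exp (F (z + \<gamma>)) = A (exp (F z))"
    using equivariant[OF assms] by blast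
  then show thesis using that[of A] by (simp add: translation_def F_inv)
qed

lemma translation_shift:
  assumes \<gamma>: "torus_exp \<gamma> = torus_exp 0" and w: "w \<in> range F"
  shows "translation \<gamma> (w + of_real t) = translation \<gamma> w + of_real t"
proof -
  obtain A where A: "linear A" "\<And>w. w \<in> range F \<Longrightarrow> exp (translation \<gamma> w) = A (exp w)"
    using exp_translation[OF \<gamma>] by metis
  have r: "w + of_real t \<in> range F" for t using w by (simp add: range_iff)
  show ?thesis
  proof (rule complex_exp.lift_unique[of UNIV "\<lambda>t. translation \<gamma> (w + of_real t)"
        "\<lambda>t. translation \<gamma> w + of_real t" 0])
    show "continuous_on UNIV (\<lambda>t. translation \<gamma> (w + of_real t))"
      by (intro continuous_on_compose2[OF translation_cont] continuous_intros) (use r in auto)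
    show "exp (translation \<gamma> (w + of_real t)) = exp (translation \<gamma> w + of_real t)" for t
    proof -
      have "exp (translation \<gamma> (w + of_real t)) = A (exp t *\<^sub>R exp w)"
        unfolding A(2)[OF r] by (simp add: exp_add exp_of_real scaleR_conv_of_real mult.commute)
      also have "\<dots> = exp t *\<^sub>R exp (translation \<gamma> w)" using A w by (simp add: linear_cmul)
      also have "\<dots> = exp (translation \<gamma> w + of_real t)"
        by (simp add: exp_add exp_of_real scaleR_conv_of_real mult.commute)
      finally show ?thesis .
    qed
  qed (auto intro!: continuous_intros)
qed

lemma height_in_range: "\<theta> \<in> heights \<Longrightarrow> \<i> * of_real \<theta> \<in> range F"
  by (simp add: range_iff)

lemma height_map_in: "height_map \<gamma> \<theta> \<in> heights"
  unfolding height_map_def by (metis range_iff translation_in_range)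

lemma Im_translation:
  assumes "torus_exp \<gamma> = torus_exp 0" "w \<in> range F"
  shows "Im (translation \<gamma> w) = height_map \<gamma> (Im w)"
proof -
  have w: "w = \<i> * of_real (Im w) + of_real (Re w)" by (simp add: complex_eq_iff)
  have "\<i> * of_real (Im w) \<in> range F" using assms(2) by (simp add: range_iff)
  then show ?thesis
    using translation_shift[OF assms(1), of "\<i> * of_real (Im w)" "Re w"] w
    by (simp add: height_map_def)
qed

lemma height_map_add:
  assumes "torus_exp \<gamma> = torus_exp 0"
  shows "height_map \<gamma> (height_map \<delta> \<theta>) = height_map (\<gamma> + \<delta>) \<theta>"
  using Im_translation[OF assms translation_in_range, of \<delta> "\<i> * of_real \<theta>"]
  by (simp add: height_map_def translation_add)

lemma height_map_0: "\<theta> \<in> heights \<Longrightarrow> height_map 0 \<theta> = \<theta>"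
  by (simp add: height_map_def translation_0 height_in_range)

lemma height_map_inverse:
  assumes "torus_exp \<gamma> = torus_exp 0" "\<theta> \<in> heights"
  shows "height_map (- \<gamma>) (height_map \<gamma> \<theta>) = \<theta>"
  using height_map_add[OF period_uminus[OF assms(1)], of \<gamma> \<theta>] height_map_0[OF assms(2)] by simp

lemma height_map_cont: "continuous_on heights (height_map \<gamma>)"
  unfolding height_map_def
  by (intro continuous_intros continuous_on_compose2[OF translation_cont]) (auto simp: height_in_range)

lemma height_map_double_mono:
  assumes \<gamma>: "torus_exp \<gamma> = torus_exp 0"
  shows "strict_mono_on heights (height_map (\<gamma> + \<gamma>))"
proof -
  have "inj_on (height_map \<gamma>) heights"
    using height_map_inverse[OF \<gamma>] by (rule inj_on_inverseI)
  then have "strict_mono_on heights (height_map \<gamma>) \<or> strict_antimono_on heights (height_map \<gamma>)"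
    using injective_eq_monotone_map[OF interval_heights height_map_cont] by blast
  then show ?thesis
    unfolding height_map_add[OF \<gamma>, symmetric]
    by (auto simp: monotone_on_def height_map_in)
qed

text \<open>A linear map commutes with \<open>-1\<close>, so its lift to angles commutes with the shift by \<open>\<pi>\<close>.\<close>

lemma height_map_pi:
  assumes \<gamma>: "torus_exp \<gamma> = torus_exp 0" and mono: "strict_mono_on heights (height_map \<gamma>)"
    and \<theta>: "\<theta> \<in> heights" "\<theta> + pi \<in> heights"
  shows "height_map \<gamma> (\<theta> + pi) = height_map \<gamma> \<theta> + pi"
proof -
  let ?h = "\<lambda>x. translation \<gamma> (\<i> * of_real x)" and ?m = "height_map \<gamma>"
  obtain A where A: "linear A" "inj A" "\<And>w. w \<in> range F \<Longrightarrow> exp (translation \<gamma> w) = A (exp w)"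
    using exp_translation[OF \<gamma>] by metis
  have eA: "exp (?h x) = A (cis x)" if "x \<in> heights" for x
    using A(3)[OF height_in_range[OF that]] by (simp add: cis_conv_exp)
  have polar: "exp (?h x) = exp (Re (?h x)) *\<^sub>R cis (?m x)" for x
    by (simp add: height_map_def exp_eq_polar scaleR_conv_of_real)
  have between: "x \<in> heights" if "\<theta> \<le> x" "x \<le> \<theta> + pi" for x
    using interval_heights \<theta> that unfolding is_interval_1 by blast
  have no: "?m x \<noteq> ?m \<theta> + pi" if x: "\<theta> < x" "x < \<theta> + pi" for x
  proof
    assume eq: "?m x = ?m \<theta> + pi"
    define r where "r = exp (Re (?h x) - Re (?h \<theta>))"
    have xI: "x \<in> heights" using between x by simp
    have "A (cis x) = - (exp (Re (?h x)) *\<^sub>R cis (?m \<theta>))"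
      unfolding eA[OF xI, symmetric] polar eq by (simp add: cis_mult[symmetric])
    also have "\<dots> = - (r *\<^sub>R A (cis \<theta>))"
      unfolding eA[OF \<theta>(1), symmetric] polar r_def by (simp add: exp_diff)
    also have "\<dots> = A (- (r *\<^sub>R cis \<theta>))" using A(1) by (simp add: linear_cmul linear_neg)
    finally have "cis x = - (r *\<^sub>R cis \<theta>)" using A(2) by (simp add: injD)
    then have "cis x * cis (- \<theta>) = - (r *\<^sub>R (cis \<theta> * cis (- \<theta>)))" by simp
    then have "cis (x - \<theta>) = - of_real r" by (simp add: cis_mult scaleR_conv_of_real)
    then have "sin (x - \<theta>) = 0" by (simp add: complex_eq_iff)
    moreover have "sin (x - \<theta>) > 0" using x by (intro sin_gt_zero) auto
    ultimately show False by simp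
  qed
  have "exp (?h (\<theta> + pi)) = - exp (?h \<theta>)"
    unfolding eA[OF \<theta>(1)] eA[OF \<theta>(2)] using A(1) by (simp add: cis_mult[symmetric] linear_neg)
  also have "\<dots> = exp (?h \<theta> + \<i> * of_real pi)" by (simp add: exp_add)
  finally obtain n :: int where "?h (\<theta> + pi) = ?h \<theta> + \<i> * of_real pi + (2 * n * pi) * \<i>"
    using exp_eq by metis
  then have n: "?m (\<theta> + pi) = ?m \<theta> + pi + 2 * n * pi" by (simp add: height_map_def)
  have "?m \<theta> < ?m (\<theta> + pi)" using mono \<theta> by (simp add: strict_mono_onD)
  then have "0 < (1 + 2 * real_of_int n) * pi" using n by (simp add: algebra_simps)
  then have "n \<ge> 0" by (simp add: zero_less_mult_iff)
  show ?thesis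
  proof (rule ccontr)
    assume "?m (\<theta> + pi) \<noteq> ?m \<theta> + pi"
    then have "n \<noteq> 0" using n by auto
    then have "n \<ge> 1" using \<open>n \<ge> 0\<close> by simp
    then have "?m \<theta> + pi < ?m (\<theta> + pi)" using n by simp
    moreover have "continuous_on {\<theta>..\<theta> + pi} ?m"
      by (rule continuous_on_subset[OF height_map_cont]) (use between in auto)
    ultimately obtain x where x: "\<theta> \<le> x" "x \<le> \<theta> + pi" "?m x = ?m \<theta> + pi"
      using IVT'[of ?m \<theta> "?m \<theta> + pi" "\<theta> + pi"] by auto
    then have "x \<noteq> \<theta>" "x \<noteq> \<theta> + pi" using \<open>?m \<theta> + pi < ?m (\<theta> + pi)\<close> by auto
    then show False using no[of x] x by simp
  qed
qed

text \<open>Here \<open>a + \<pi>\<close> is the supremum of the heights. Squares of deck transformations are considered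
  because they preserve orientation.\<close>

lemma height_map_fixed:
  assumes \<gamma>: "torus_exp \<gamma> = torus_exp 0"
    and \<theta>: "\<theta> \<in> heights" and a: "a \<in> heights" "\<theta> < a"
    and ub: "\<And>x. x \<in> heights \<Longrightarrow> x < a + pi" and sup: "\<And>y. y < a + pi \<Longrightarrow> \<exists>x\<in>heights. y < x"
  shows "height_map (\<gamma> + \<gamma>) a = a"
proof -
  have "\<not> height_map (\<gamma> + \<gamma>) a < a" if \<gamma>: "torus_exp \<gamma> = torus_exp 0" for \<gamma>
  proof
    let ?m = "height_map (\<gamma> + \<gamma>)"
    have mono: "strict_mono_on heights ?m" by (rule height_map_double_mono[OF \<gamma>])
    have \<gamma>2: "torus_exp (\<gamma> + \<gamma>) = torus_exp 0" by (rule period_add[OF \<gamma> \<gamma>])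
    assume less: "?m a < a"
    have between: "x \<in> heights" if "\<theta> \<le> x" "x < a + pi" for x
      using interval_heights \<theta> sup[OF that(2)] that(1) unfolding is_interval_1 by (meson less_imp_le)
    have \<theta>pi: "\<theta> + pi \<in> heights" using between a pi_gt_zero by simp
    have "max (?m a + pi) (?m (\<theta> + pi)) < a + pi" using less ub[OF height_map_in] by simp
    then obtain y where y: "y \<in> heights" "?m a + pi < y" "?m (\<theta> + pi) < y" using sup by fastforce
    define x where "x = height_map (- (\<gamma> + \<gamma>)) y"
    have x: "x \<in> heights" "?m x = y"
      using height_map_in height_map_inverse[OF period_uminus[OF \<gamma>2] y(1)] by (auto simp: x_def)
    have "\<theta> + pi < x" using y(3) x \<theta>pi mono by (metis strict_mono_on_less)
    then have xpi: "x - pi \<in> heights" "x - pi < a" using between[of "x - pi"] ub[OF x(1)] pi_gt_zero by auto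
    have "?m (x - pi) = y - pi" using height_map_pi[OF \<gamma>2 mono xpi(1)] x by simp
    then have "?m a < ?m (x - pi)" using y(2) by simp
    moreover have "?m (x - pi) < ?m a" using mono xpi a(1) by (simp add: strict_mono_onD)
    ultimately show False by simp
  qed
  note not_less = this
  have "\<not> a < height_map (\<gamma> + \<gamma>) a"
  proof
    assume "a < height_map (\<gamma> + \<gamma>) a"
    have \<gamma>2: "torus_exp (\<gamma> + \<gamma>) = torus_exp 0" by (rule period_add[OF \<gamma> \<gamma>])
    have "height_map (- \<gamma> + - \<gamma>) a < height_map (- \<gamma> + - \<gamma>) (height_map (\<gamma> + \<gamma>) a)"
      using height_map_double_mono[OF period_uminus[OF \<gamma>]] \<open>a < _\<close> a(1) height_map_in
      by (simp add: strict_mono_onD)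
    also have "\<dots> = a" using height_map_inverse[OF \<gamma>2 a(1)] by simp
    finally show False using not_less[OF period_uminus[OF \<gamma>]] by simp
  qed
  then show ?thesis using not_less[OF \<gamma>] by simp
qed

text \<open>The translations induced on an invariant line would form a free abelian group of rank two, but a
  subgroup of rank two in \<open>\<real>\<close> is not discrete.\<close>

lemma no_invariant_line:
  assumes a: "a \<in> heights"
    and fixed: "\<And>\<gamma>. torus_exp \<gamma> = torus_exp 0 \<Longrightarrow> height_map (\<gamma> + \<gamma>) a = a"
  shows False
proof -
  define w where "w = \<i> * of_real a"
  have w: "w \<in> range F" unfolding w_def using height_in_range[OF a] .
  define c where "c \<gamma> = Re (translation \<gamma> w)" for \<gamma>
  have tr: "translation (\<gamma> + \<gamma>) w = w + of_real (c (\<gamma> + \<gamma>))" if "torus_exp \<gamma> = torus_exp 0" for \<gamma>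
    using fixed[OF that] by (simp add: complex_eq_iff w_def c_def height_map_def)
  define L :: "int \<Rightarrow> int \<Rightarrow> complex" where "L m n = Complex (2 * pi * m) (2 * pi * n)" for m n
  have L: "torus_exp (L m n) = torus_exp 0" for m n
    by (simp add: torus_exp_def L_def cis_multiple_2pi)
  define e where "e m n = c (L m n + L m n)" for m n
  have add: "e (m + m') (n + n') = e m n + e m' n'" for m n m' n'
  proof -
    let ?g = "L m n + L m n" and ?g' = "L m' n' + L m' n'"
    have g: "L (m + m') (n + n') + L (m + m') (n + n') = ?g + ?g'"
      by (simp add: L_def complex_eq_iff algebra_simps)
    have "translation (?g + ?g') w = translation ?g (w + of_real (c ?g'))"
      by (simp only: translation_add[symmetric, of ?g] tr[OF L])
    also have "\<dots> = w + of_real (c ?g) + of_real (c ?g')"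
      by (simp only: translation_shift[OF period_add[OF L L] w] tr[OF L])
    finally show ?thesis unfolding e_def g by (simp add: c_def w_def)
  qed
  have add_0: "e 0 0 = 0" using add[of 0 0 0 0] by simp
  have e1: "e m 0 = of_int m * e 1 0" for m
  proof (induction m rule: int_induct[of _ 0])
    case (step1 i)
    then show ?case using add[of i 1 0 0] by (simp add: algebra_simps)
  next
    case (step2 i)
    then show ?case using add[of "i - 1" 1 0 0] by (simp add: algebra_simps)
  qed (use add_0 in simp)
  have e2: "e 0 n = of_int n * e 0 1" for n
  proof (induction n rule: int_induct[of _ 0])
    case (step1 i)
    then show ?case using add[of 0 0 i 1] by (simp add: algebra_simps)
  next
    case (step2 i)
    then show ?case using add[of 0 0 "i - 1" 1] by (simp add: algebra_simps)
  qed (use add_0 in simp)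
  have e: "e m n = of_int m * e 1 0 + of_int n * e 0 1" for m n
    using add[of m 0 0 n] e1[of m] e2[of n] by simp
  have "isCont (inv F) w"
  proof -
    have "open (range F)" using invariance_of_domain[OF F_cont open_UNIV F_inj] .
    then show ?thesis using homeomorphism_cont2[OF homeo] w by (metis continuous_on_eq_continuous_at)
  qed
  then obtain \<eta> where \<eta>: "\<eta> > 0" "\<And>v. dist v w < \<eta> \<Longrightarrow> dist (inv F v) (inv F w) < 1"
    unfolding continuous_at_eps_delta using zero_less_one by blast
  have far: "\<eta> \<le> \<bar>e m n\<bar>" if "(m, n) \<noteq> (0, 0)" for m n
  proof (rule ccontr)
    assume "\<not> \<eta> \<le> \<bar>e m n\<bar>"
    then have "dist (w + of_real (e m n)) w < \<eta>" by (simp add: dist_norm)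
    then have "dist (inv F (w + of_real (e m n))) (inv F w) < 1" by (rule \<eta>(2))
    moreover have "w + of_real (e m n) = F (inv F w + (L m n + L m n))"
      using tr[OF L, of m n] unfolding e_def translation_def by (rule sym)
    then have "inv F (w + of_real (e m n)) = inv F w + (L m n + L m n)" by (simp only: inv_F)
    ultimately have "norm (L m n + L m n) < 1" by (simp add: dist_norm)
    then have "\<bar>Re (L m n + L m n)\<bar> < 1" "\<bar>Im (L m n + L m n)\<bar> < 1"
      using abs_Re_le_cmod abs_Im_le_cmod le_less_trans by blast+
    then have "4 * pi * \<bar>real_of_int m\<bar> < 1" "4 * pi * \<bar>real_of_int n\<bar> < 1"
      by (auto simp: L_def abs_mult)
    moreover have "x = 0" if "4 * pi * \<bar>real_of_int x\<bar> < 1" for x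
    proof (rule ccontr)
      assume "x \<noteq> 0"
      then have "1 \<le> \<bar>real_of_int x\<bar>" by linarith
      then have "4 * pi * 1 \<le> 4 * pi * \<bar>real_of_int x\<bar>" by (intro mult_left_mono) auto
      then show False using that pi_gt3 by linarith
    qed
    ultimately show False using \<open>(m, n) \<noteq> (0, 0)\<close> by blast
  qed
  have nz: "e 1 0 \<noteq> 0" using far[of 1 0] \<eta>(1) by auto
  obtain N :: nat where N: "N > 0" "\<bar>e 1 0\<bar> / N < \<eta>"
  proof -
    obtain N :: nat where N: "\<bar>e 1 0\<bar> / \<eta> < N" using reals_Archimedean2 by blast
    moreover have "0 < \<bar>e 1 0\<bar> / \<eta>" using nz \<eta>(1) by simp
    ultimately have "0 < real N" by linarith
    then show thesis using that[of N] N \<eta>(1) by (simp add: field_simps)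
  qed
  obtain h k where hk: "0 < k" "\<bar>of_int k * (e 0 1 / e 1 0) - of_int h\<bar> < 1 / N"
    using Dirichlet_approx[OF N(1), of "e 0 1 / e 1 0"] by metis
  have "e (- h) k = e 1 0 * (of_int k * (e 0 1 / e 1 0) - of_int h)"
    using nz by (simp add: e[of "- h" k] field_simps)
  then have "\<bar>e (- h) k\<bar> = \<bar>e 1 0\<bar> * \<bar>of_int k * (e 0 1 / e 1 0) - of_int h\<bar>" by (simp add: abs_mult)
  also have "\<dots> < \<bar>e 1 0\<bar> * (1 / N)" using hk(2) nz by (intro mult_strict_left_mono) auto
  finally show False using N(2) far[of "- h" k] hk(1) by simp
qed

lemma not_bdd_above_heights:
  assumes \<theta>: "\<theta> \<in> heights" "\<theta> + 2 * pi \<in> heights"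
  shows "\<not> bdd_above heights"
proof
  assume bdd: "bdd_above heights"
  define a where "a = Sup heights - pi"
  have ub: "x < a + pi" if x: "x \<in> heights" for x
  proof -
    obtain e where e: "e > 0" "ball x e \<subseteq> heights" using open_heights x open_contains_ball by blast
    then have "x + e / 2 \<in> heights" by (auto simp: dist_real_def)
    then show ?thesis using cSup_upper[OF _ bdd] e(1) by (fastforce simp: a_def)
  qed
  have sup: "\<exists>x\<in>heights. y < x" if "y < a + pi" for y
    using less_cSup_iff[of heights y] bdd that \<theta>(1) by (auto simp: a_def)
  have "\<theta> < a" using ub[OF \<theta>(2)] pi_gt_zero by linarith
  moreover have "a \<in> heights"
  proof -
    obtain x where "x \<in> heights" "a < x" using sup[of a] pi_gt_zero by auto
    then show ?thesis using interval_heights \<theta>(1) \<open>\<theta> < a\<close> unfolding is_interval_1 by (meson less_imp_le)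
  qed
  ultimately show False using no_invariant_line height_map_fixed[OF _ \<theta>(1)] ub sup by blast
qed

end

lemma log_development_cnj:
  assumes "log_development F"
  shows "log_development (cnj \<circ> F)"
proof -
  interpret log_development F by (rule assms)
  show ?thesis
  proof
    show "continuous_on UNIV (cnj \<circ> F)" unfolding comp_def by (intro continuous_intros F_cont)
    show "inj (cnj \<circ> F)" using F_inj by (auto simp: inj_def)
    show "(cnj \<circ> F) z + of_real t \<in> range (cnj \<circ> F)" for z t
    proof -
      obtain z' where "F z + of_real t = F z'" using horizontal by blast
      then have "(cnj \<circ> F) z + of_real t = (cnj \<circ> F) z'" by (metis comp_apply complex_cnj_add complex_cnj_complex_of_real)
      then show ?thesis by blast
    qed
    fix \<gamma> assume "torus_exp \<gamma> = torus_exp 0"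
    then obtain A where A: "linear A" "inj A" "\<And>z. exp (F (z + \<gamma>)) = A (exp (F z))"
      using equivariant by blast
    have "linear (cnj \<circ> (A \<circ> cnj))"
      by (intro linear_compose A(1)) (auto intro: bounded_linear.linear[OF bounded_linear_cnj])
    moreover have "inj (cnj \<circ> (A \<circ> cnj))" by (rule injI) (auto dest!: injD[OF A(2)])
    ultimately show "\<exists>A. linear A \<and> inj A \<and> (\<forall>z. exp ((cnj \<circ> F) (z + \<gamma>)) = A (exp ((cnj \<circ> F) z)))"
      by (intro exI[of _ "cnj \<circ> (A \<circ> cnj)"]) (simp add: exp_cnj flip: A(3))
  qed
qed

context log_development
begin

lemma surj_if_not_inj_exp:
  assumes "\<not> inj (\<lambda>z. exp (F z))"
  shows "range F = UNIV"
proof -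
  interpret cnj: log_development "cnj \<circ> F" by (rule log_development_cnj) unfold_locales
  obtain p q where pq: "exp (F p) = exp (F q)" "p \<noteq> q" using assms by (auto simp: inj_def)
  then obtain n :: int where n: "F p = F q + (2 * n * pi) * \<i>" using exp_eq by metis
  have "n \<noteq> 0"
  proof
    assume "n = 0"
    then have "F p = F q" using n by simp
    then show False using F_inj pq(2) by (simp add: inj_eq)
  qed
  have "\<exists>\<theta>. \<theta> \<in> heights \<and> \<theta> + 2 * pi \<in> heights"
  proof -
    define l u where "l = min (Im (F p)) (Im (F q))" and "u = max (Im (F p)) (Im (F q))"
    have lu: "l \<in> heights" "u \<in> heights" by (auto simp: l_def u_def min_def max_def heights_def)
    have "u - l = \<bar>Im (F p) - Im (F q)\<bar>" by (simp add: l_def u_def)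
    also have "\<dots> = 2 * pi * \<bar>real_of_int n\<bar>" using n by (simp add: abs_mult)
    also have "\<dots> \<ge> 2 * pi * 1" using \<open>n \<noteq> 0\<close> by (intro mult_left_mono) auto
    finally have "l \<le> l + 2 * pi" "l + 2 * pi \<le> u" by auto
    then show ?thesis using lu interval_heights unfolding is_interval_1 by blast
  qed
  then obtain \<theta> where \<theta>: "\<theta> \<in> heights" "\<theta> + 2 * pi \<in> heights" by blast
  have cnj_heights: "cnj.heights = uminus ` heights"
    by (force simp: cnj.heights_def heights_def)
  have "\<not> bdd_above heights" using not_bdd_above_heights[OF \<theta>] .
  moreover have "\<not> bdd_above (uminus ` heights)"
  proof -
    have "- (\<theta> + 2 * pi) \<in> uminus ` heights" "- (\<theta> + 2 * pi) + 2 * pi \<in> uminus ` heights"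
      using imageI[OF \<theta>(1), of uminus] imageI[OF \<theta>(2), of uminus] by simp_all
    then show ?thesis using cnj.not_bdd_above_heights unfolding cnj_heights by blast
  qed
  ultimately have "y \<in> heights" for y
  proof -
    obtain x where x: "x \<in> heights" "y < x"
      using \<open>\<not> bdd_above heights\<close> unfolding bdd_above_def by (meson not_le)
    obtain x' where x': "x' \<in> uminus ` heights" "- y < x'"
      using \<open>\<not> bdd_above (uminus ` heights)\<close> unfolding bdd_above_def by (meson not_le)
    then have "- x' \<in> heights" "- x' < y" by auto
    then show ?thesis using x interval_heights unfolding is_interval_1 by (meson less_imp_le)
  qed
  then show ?thesis using range_iff by auto
qed

lemma covering_space_exp:
  "covering_space UNIV (\<lambda>z. exp (F z)) (range (\<lambda>z. exp (F z)))"
proof (cases "inj (\<lambda>z. exp (F z))")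
  case True
  have "continuous_on UNIV (\<lambda>z. exp (F z))" by (intro continuous_intros F_cont)
  then obtain s where "homeomorphism UNIV (range (\<lambda>z. exp (F z))) (\<lambda>z. exp (F z)) s"
    using invariance_of_domain_homeomorphism[OF open_UNIV _ _ True] by auto
  then show ?thesis by (rule homeomorphism_imp_covering_space)
next
  case False
  then have surj: "range F = UNIV" by (rule surj_if_not_inj_exp)
  then have "homeomorphism UNIV UNIV F (inv F)" using homeo by simp
  then have "covering_space UNIV (\<lambda>z. exp (F z)) (- {0})"
    by (rule covering_space_homeomorphic_transfer[OF covering_space_exp_punctured_plane])
       (auto intro: homeomorphism_ident)
  then show ?thesis using covering_space_imp_surjective by metis
qed

end

section \<open>Affine holonomy\<close>

lemma affine_eq_on_open:
  fixes A B :: "complex \<Rightarrow> complex"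
  assumes A: "linear A" and B: "linear B" and U: "open U" "u \<in> U"
    and eq: "\<And>w. w \<in> U \<Longrightarrow> A w + b = B w + c"
  shows "A w + b = B w + c"
proof -
  obtain e where e: "e > 0" "ball u e \<subseteq> U" using U open_contains_ball by blast
  have lin: "A x = B x" for x
  proof (cases "x = 0")
    case True
    then show ?thesis using A B by (simp add: linear_0)
  next
    case False
    define t where "t = e / (2 * norm x)"
    have t: "t > 0" using e(1) False by (simp add: t_def)
    have "norm (t *\<^sub>R x) < e" using e(1) False by (simp add: t_def)
    then have "u + t *\<^sub>R x \<in> U" using e(2) by (auto simp: dist_norm)
    then have "A (u + t *\<^sub>R x) + b = B (u + t *\<^sub>R x) + c" by (rule eq)
    moreover have "A u + b = B u + c" using eq U(2) .
    moreover have "A (u + t *\<^sub>R x) + b = (A u + b) + t *\<^sub>R A x"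
      "B (u + t *\<^sub>R x) + c = (B u + c) + t *\<^sub>R B x"
      using A B by (simp_all add: linear_add linear_cmul)
    ultimately have "t *\<^sub>R A x = t *\<^sub>R B x" by simp
    then show ?thesis using t by simp
  qed
  moreover have "A u + b = B u + c" using eq U(2) .
  ultimately show ?thesis by simp
qed

lemma complex_real_basis:
  fixes k l :: complex
  assumes "k \<noteq> 0" "\<And>t. l \<noteq> t *\<^sub>R k"
  obtains \<alpha> \<beta> where "w = \<alpha> *\<^sub>R k + \<beta> *\<^sub>R l"
proof -
  have "Im (l / k) \<noteq> 0"
  proof
    assume "Im (l / k) = 0"
    then have "l / k = of_real (Re (l / k))" by (simp add: complex_eq_iff)
    then have "l = Re (l / k) *\<^sub>R k" using assms(1) by (simp add: scaleR_conv_of_real field_simps)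
    then show False using assms(2) by blast
  qed
  define r q where "r = w / k" and "q = l / k"
  define \<beta> where "\<beta> = Im r / Im q"
  define \<alpha> where "\<alpha> = Re r - \<beta> * Re q"
  have "r = of_real \<alpha> + of_real \<beta> * q"
    using \<open>Im (l / k) \<noteq> 0\<close> unfolding \<alpha>_def \<beta>_def q_def[symmetric] by (simp add: complex_eq_iff)
  then have "w / k = of_real \<alpha> + of_real \<beta> * (l / k)" by (simp add: r_def q_def)
  then have "w = \<alpha> *\<^sub>R k + \<beta> *\<^sub>R l" using assms(1) by (simp add: scaleR_conv_of_real field_simps)
  then show thesis by (rule that)
qed

lemma commuting_affine_maps:
  fixes A B :: "complex \<Rightarrow> complex"
  assumes A: "linear A" and B: "linear B" and comm: "\<And>w. A (B w + c) + b = B (A w + b) + c"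
  shows "(\<exists>v. v \<noteq> 0 \<and> A v = v \<and> B v = v) \<or> (\<exists>p. A p + b = p \<and> B p + c = p)"
proof -
  define N P where "N w = A w - w" and "P w = B w - w" for w
  have N: "linear N" and P: "linear P"
    unfolding N_def P_def using A B by (auto intro: linear_compose_sub linear_id[unfolded id_def])
  have "A c + b = B b + c" using comm[of 0] A B by (simp add: linear_0)
  then have bc: "N c = P b" by (simp add: N_def P_def algebra_simps)
  have "A (B w) = B (A w)" for w
  proof -
    have "(A c + b) + A (B w) = (B b + c) + B (A w)"
      using comm[of w] A B by (simp add: linear_add algebra_simps)
    then show ?thesis using \<open>A c + b = B b + c\<close> by simp
  qed
  then have NP: "N (P w) = P (N w)" for w
    using A B by (simp add: N_def P_def linear_diff)
  have fix_iff: "A p + b = p \<longleftrightarrow> N p = - b" "B p + c = p \<longleftrightarrow> P p = - c" for p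
    by (auto simp: N_def P_def algebra_simps eq_neg_iff_add_eq_0)
  have ker_iff: "A v = v \<longleftrightarrow> N v = 0" "B v = v \<longleftrightarrow> P v = 0" for v by (simp_all add: N_def P_def)
  consider "inj N" | "inj P" | k l where "k \<noteq> 0" "N k = 0" "l \<noteq> 0" "P l = 0"
    using linear_injective_0[OF N] linear_injective_0[OF P] by metis
  then show ?thesis
  proof cases
    case 1
    then obtain p where p: "N p = - b" using linear_inj_imp_surj[OF N] by (metis surjD)
    have "N (P p + c) = 0" using NP[of p] p bc N P by (simp add: linear_add linear_neg)
    then have "P p + c = 0" using 1 linear_injective_0[OF N] by blast
    then show ?thesis using p fix_iff by (auto simp: eq_neg_iff_add_eq_0)
  next
    case 2
    then obtain p where p: "P p = - c" using linear_inj_imp_surj[OF P] by (metis surjD)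
    have "P (N p) = - P b" using NP[of p] p bc N by (simp add: linear_neg)
    then have "P (N p + b) = 0" using P by (simp add: linear_add)
    then have "N p + b = 0" using 2 linear_injective_0[OF P] by blast
    then show ?thesis using p fix_iff by (auto simp: eq_neg_iff_add_eq_0)
  next
    case 3
    show ?thesis
    proof (cases "P k = 0 \<or> N l = 0")
      case True
      then show ?thesis using 3 ker_iff by blast
    next
      case False
      have "l \<noteq> t *\<^sub>R k" for t
        using False 3 P by (auto simp: linear_cmul)
      then have basis: "\<exists>\<alpha> \<beta>. w = \<alpha> *\<^sub>R k + \<beta> *\<^sub>R l" for w
        using complex_real_basis[OF 3(1)] by metis
      have N_eq: "N (\<alpha> *\<^sub>R k + \<beta> *\<^sub>R l) = \<beta> *\<^sub>R N l" and P_eq: "P (\<alpha> *\<^sub>R k + \<beta> *\<^sub>R l) = \<alpha> *\<^sub>R P k"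
        for \<alpha> \<beta> using 3 N P by (simp_all add: linear_add linear_cmul)
      have "P (N l) = 0" "N (P k) = 0" using NP[of l] NP[of k] 3 N P by (simp_all add: linear_0)
      obtain \<nu>' \<nu> where "N l = \<nu>' *\<^sub>R k + \<nu> *\<^sub>R l" using basis by blast
      with \<open>P (N l) = 0\<close> have \<nu>: "N l = \<nu> *\<^sub>R l" "\<nu> \<noteq> 0" using P_eq[of \<nu>' \<nu>] False by auto
      obtain \<kappa> \<kappa>' where "P k = \<kappa> *\<^sub>R k + \<kappa>' *\<^sub>R l" using basis by blast
      with \<open>N (P k) = 0\<close> have \<kappa>: "P k = \<kappa> *\<^sub>R k" "\<kappa> \<noteq> 0" using N_eq[of \<kappa> \<kappa>'] False by auto
      obtain b1 b2 c1 c2 where b: "b = b1 *\<^sub>R k + b2 *\<^sub>R l" and c: "c = c1 *\<^sub>R k + c2 *\<^sub>R l"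
        using basis by meson
      have eq: "(c2 * \<nu>) *\<^sub>R l = (b1 * \<kappa>) *\<^sub>R k"
        using bc unfolding b c N_eq P_eq by (simp add: \<nu>(1) \<kappa>(1))
      have "N ((c2 * \<nu>) *\<^sub>R l) = 0" unfolding eq using 3 N by (simp add: linear_cmul)
      then have c2: "c2 = 0" using N False \<nu>(2) by (simp add: linear_cmul)
      then have b1: "b1 = 0" using eq \<kappa>(2) 3(1) by simp
      define p where "p = (- c1 / \<kappa>) *\<^sub>R k + (- b2 / \<nu>) *\<^sub>R l"
      have "N p = - b" "P p = - c"
        unfolding p_def N_eq P_eq b c c2 b1 using \<nu> \<kappa> by simp_all
      then show ?thesis using fix_iff by blast
    qed
  qed
qed

lemma period_generated:
  assumes \<gamma>: "torus_exp \<gamma> = torus_exp 0"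
    and gen: "Q (of_real (2 * pi))" "Q (\<i> * of_real (2 * pi))" and diff: "\<And>\<gamma> \<delta>. Q \<gamma> \<Longrightarrow> Q \<delta> \<Longrightarrow> Q (\<gamma> - \<delta>)"
  shows "Q \<gamma>"
proof -
  have Q0: "Q 0" using diff[OF gen(1) gen(1)] by simp
  have neg: "Q (- \<gamma>)" if "Q \<gamma>" for \<gamma> using diff[OF Q0 that] by simp
  have add: "Q (\<gamma> + \<delta>)" if "Q \<gamma>" "Q \<delta>" for \<gamma> \<delta> using diff[OF that(1) neg[OF that(2)]] by simp
  have mult: "Q (of_int m * \<gamma>)" if "Q \<gamma>" for m \<gamma>
  proof (induction m rule: int_induct[of _ 0])
    case (step1 i)
    then show ?case using add[OF step1(2) that] by (simp add: algebra_simps)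
  next
    case (step2 i)
    then show ?case using diff[OF step2(2) that] by (simp add: algebra_simps)
  qed (use Q0 in simp)
  have "cos (Re \<gamma>) = 1" "cos (Im \<gamma>) = 1"
    using \<gamma> by (simp_all add: torus_exp_def complex_eq_iff)
  then obtain m n :: int where "Re \<gamma> = of_int m * 2 * pi" "Im \<gamma> = of_int n * 2 * pi"
    unfolding cos_one_2pi_int by blast
  then have "\<gamma> = of_int m * of_real (2 * pi) + of_int n * (\<i> * of_real (2 * pi))"
    by (simp add: complex_eq_iff)
  then show ?thesis using add[OF mult[OF gen(1)] mult[OF gen(2)]] by metis
qed

context plane_immersion
begin

lemma holonomy_global:
  assumes loc: "\<And>z. \<exists>A b N. linear A \<and> inj A \<and> open N \<and> z \<in> N \<and> (\<forall>y\<in>N. f (y + \<gamma>) = A (f y) + b)"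
  shows "\<exists>A b. linear A \<and> inj A \<and> (\<forall>z. f (z + \<gamma>) = A (f z) + b)"
proof -
  obtain A b N where A: "linear A" "inj A" "open N" "0 \<in> N" "\<forall>y\<in>N. f (y + \<gamma>) = A (f y) + b"
    using loc[of 0] by blast
  define G where "G = {z. \<exists>N. open N \<and> z \<in> N \<and> (\<forall>y\<in>N. f (y + \<gamma>) = A (f y) + b)}"
  have "open G" unfolding G_def by (subst open_subopen) blast
  moreover have "open (- G)"
  proof (subst open_subopen, clarify)
    fix z assume "z \<notin> G"
    obtain B c N where B: "linear B" "open N" "z \<in> N" "\<forall>y\<in>N. f (y + \<gamma>) = B (f y) + c"
      using loc[of z] by blast
    have "N \<inter> G = {}"
    proof (rule ccontr)
      assume "N \<inter> G \<noteq> {}"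
      then obtain y N' where y: "y \<in> N" "open N'" "y \<in> N'" "\<forall>x\<in>N'. f (x + \<gamma>) = A (f x) + b"
        unfolding G_def by blast
      have "A w + b = B w + c" for w
      proof (rule affine_eq_on_open[OF A(1) B(1)])
        show "open (f ` (N \<inter> N'))" using B(2) y(2) by (intro open_map open_Int)
        show "f y \<in> f ` (N \<inter> N')" using y by blast
        show "A w + b = B w + c" if "w \<in> f ` (N \<inter> N')" for w using that B(4) y(4) by force
      qed
      then have "z \<in> G" using B by (auto simp: G_def)
      then show False using \<open>z \<notin> G\<close> by blast
    qed
    then show "\<exists>T. open T \<and> z \<in> T \<and> T \<subseteq> - G" using B by blast
  qed
  moreover have "0 \<in> G" using A by (auto simp: G_def)
  ultimately have "G = UNIV"
    using clopen[of G] by (auto simp: closed_def)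
  then have "f (z + \<gamma>) = A (f z) + b" for z by (auto simp: G_def)
  then show ?thesis using A by blast
qed

lemma covering_if_common_fixed_vector:
  assumes v: "v \<noteq> 0"
    and hol: "\<And>\<gamma>. torus_exp \<gamma> = torus_exp 0 \<Longrightarrow> \<exists>A b. linear A \<and> A v = v \<and> (\<forall>z. f (z + \<gamma>) = A (f z) + b)"
  shows "covering_space UNIV f (range f)"
proof -
  have flow: "\<exists>\<Psi>. continuous_on (ball 0 T \<times> UNIV) \<Psi> \<and>
      (\<forall>t\<in>ball 0 T. \<forall>z. f (\<Psi> (t, z)) = f z + t *\<^sub>R v) \<and> (\<forall>z. \<Psi> (0, z) = z)" for T
  proof (rule flow_lift)
    show "continuous_on UNIV (\<lambda>(t, w). w + t *\<^sub>R v)"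
      by (auto simp: case_prod_beta intro!: continuous_intros)
    fix \<gamma> assume "torus_exp \<gamma> = torus_exp 0"
    then obtain A b where A: "linear A" "A v = v" "\<And>z. f (z + \<gamma>) = A (f z) + b"
      using hol by blast
    then show "\<exists>g. (\<forall>z. f (z + \<gamma>) = g (f z)) \<and> (\<forall>t w. g w + t *\<^sub>R v = g (w + t *\<^sub>R v))"
      by (intro exI[of _ "\<lambda>w. A w + b"]) (simp add: linear_add linear_cmul)
  qed (auto simp: algebra_simps)
  interpret quotient: plane_immersion "\<lambda>z. f z / v"
  proof
    show "continuous_on UNIV (\<lambda>z. f z / v)" using v by (intro continuous_intros cont) auto
    show "\<exists>N. open N \<and> z \<in> N \<and> inj_on (\<lambda>z. f z / v) N" for z
      using loc_inj[of z] v by (simp add: inj_on_def)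
  qed
  have "inj (\<lambda>z. f z / v)"
  proof (rule quotient.inj_if_horizontal_flow)
    fix T
    obtain \<Psi> where \<Psi>: "continuous_on (ball 0 T \<times> UNIV) \<Psi>" "\<forall>z. \<Psi> (0, z) = z"
      "\<forall>t\<in>ball 0 T. \<forall>z. f (\<Psi> (t, z)) = f z + t *\<^sub>R v"
      using flow[of T] by blast
    then have "\<forall>t\<in>ball 0 T. \<forall>z. f (\<Psi> (t, z)) / v = f z / v + of_real t"
      using v by (simp add: add_divide_distrib scaleR_conv_of_real)
    then show "\<exists>\<Psi>. continuous_on (ball 0 T \<times> UNIV) \<Psi> \<and>
      (\<forall>t\<in>ball 0 T. \<forall>z. f (\<Psi> (t, z)) / v = f z / v + of_real t) \<and> (\<forall>z. \<Psi> (0, z) = z)"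
      using \<Psi> by blast
  qed
  then have "inj f" using v by (simp add: inj_def)
  then show ?thesis by (rule covering_space_if_inj)
qed

lemma covering_if_linear_holonomy:
  assumes hol: "\<And>\<gamma>. torus_exp \<gamma> = torus_exp 0 \<Longrightarrow> \<exists>A. linear A \<and> inj A \<and> (\<forall>z. f (z + \<gamma>) = A (f z))"
  shows "covering_space UNIV f (range f)"
proof -
  have flow: "\<exists>\<Psi>. continuous_on (ball 0 T \<times> UNIV) \<Psi> \<and>
      (\<forall>t\<in>ball 0 T. \<forall>z. f (\<Psi> (t, z)) = exp t *\<^sub>R f z) \<and> (\<forall>z. \<Psi> (0, z) = z)" for T
  proof (rule flow_lift)
    show "continuous_on UNIV (\<lambda>(t, w). exp t *\<^sub>R w :: complex)"
      by (auto simp: case_prod_beta intro!: continuous_intros)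
    fix \<gamma> assume "torus_exp \<gamma> = torus_exp 0"
    then obtain A where A: "linear A" "\<And>z. f (z + \<gamma>) = A (f z)"
      using hol by blast
    then show "\<exists>g. (\<forall>z. f (z + \<gamma>) = g (f z)) \<and> (\<forall>t w. exp t *\<^sub>R g w = g (exp t *\<^sub>R w))"
      by (intro exI[of _ A]) (simp add: linear_cmul)
  qed (auto simp: exp_add)
  show ?thesis
  proof (cases "\<exists>z. f z = 0")
    case True
    then obtain z0 where "f z0 = 0" by blast
    then show ?thesis by (intro covering_space_if_inj inj_if_euler_flow_zero[OF flow])
  next
    case False
    then have "\<And>z. z \<in> UNIV \<Longrightarrow> f z \<noteq> 0" by blast
    then obtain F where "continuous_on UNIV F" "\<And>z. z \<in> UNIV \<Longrightarrow> f z = exp (F z)"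
      using continuous_logarithm_on_contractible[OF cont contractible_UNIV] by metis
    then have F: "continuous_on UNIV F" "\<And>z. f z = exp (F z)" by auto
    interpret F: plane_immersion F
    proof
      show "\<exists>N. open N \<and> z \<in> N \<and> inj_on F N" for z
        using loc_inj[of z] by (simp add: F(2) inj_on_def) metis
    qed (rule F(1))
    have F_flow: "\<exists>\<Psi>. continuous_on (ball 0 T \<times> UNIV) \<Psi> \<and>
      (\<forall>t\<in>ball 0 T. \<forall>z. F (\<Psi> (t, z)) = F z + of_real t) \<and> (\<forall>z. \<Psi> (0, z) = z)" for T
    proof -
      obtain \<Psi> where \<Psi>: "continuous_on (ball 0 T \<times> UNIV) \<Psi>" "\<forall>z. \<Psi> (0, z) = z"
        "\<forall>t\<in>ball 0 T. \<forall>z. f (\<Psi> (t, z)) = exp t *\<^sub>R f z"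
        using flow[of T] by blast
      have "F (\<Psi> (t, z)) = F z + of_real t" if t: "t \<in> ball 0 T" for t z
      proof (rule complex_exp.lift_unique[of "ball 0 T" "\<lambda>t. F (\<Psi> (t, z))" "\<lambda>t. F z + of_real t" 0])
        show "continuous_on (ball 0 T) (\<lambda>t. F (\<Psi> (t, z)))"
          by (intro continuous_on_compose2[OF F(1)] continuous_on_compose2[OF \<Psi>(1)])
             (auto intro!: continuous_intros)
        show "exp (F (\<Psi> (t, z))) = exp (F z + of_real t)" if "t \<in> ball 0 T" for t
          using \<Psi>(3) that by (simp add: F(2) exp_add exp_of_real scaleR_conv_of_real mult.commute)
        have "0 < T" using t by (metis abs_ge_zero le_less_trans mem_ball_0 real_norm_def)
        then show "0 \<in> ball 0 T" by simp
      qed (use t \<Psi>(2) in \<open>auto intro!: continuous_intros\<close>)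
      then show ?thesis using \<Psi> by blast
    qed
    interpret log_development F
    proof
      show "inj F" by (rule F.inj_if_horizontal_flow[OF F_flow])
      show "F z + of_real t \<in> range F" for z t
      proof -
        obtain \<Psi> where "\<forall>s\<in>ball 0 (\<bar>t\<bar> + 1). \<forall>z. F (\<Psi> (s, z)) = F z + of_real s"
          using F_flow[of "\<bar>t\<bar> + 1"] by blast
        then have "F (\<Psi> (t, z)) = F z + of_real t" by simp
        then show ?thesis by (metis rangeI)
      qed
    qed (use F hol in auto)
    show ?thesis using covering_space_exp unfolding F(2)[symmetric] .
  qed
qed

lemma covering_if_affine_holonomy:
  assumes hol: "\<And>\<gamma>. torus_exp \<gamma> = torus_exp 0 \<Longrightarrow> \<exists>A b. linear A \<and> inj A \<and> (\<forall>z. f (z + \<gamma>) = A (f z) + b)"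
  shows "covering_space UNIV f (range f)"
proof -
  define e1 e2 :: complex where "e1 = of_real (2 * pi)" and "e2 = \<i> * of_real (2 * pi)"
  have "torus_exp e1 = torus_exp 0" "torus_exp e2 = torus_exp 0"
    by (simp_all add: torus_exp_def e1_def e2_def complex_eq_iff)
  then obtain A b B c where A: "linear A" "inj A" "\<And>z. f (z + e1) = A (f z) + b"
    and B: "linear B" "inj B" "\<And>z. f (z + e2) = B (f z) + c"
    using hol by metis
  have comm: "A (B w + c) + b = B (A w + b) + c" for w
  proof -
    have "A (B w) + (A c + b) = B (A w) + (B b + c)"
    proof (rule affine_eq_on_open[of "\<lambda>w. A (B w)" "\<lambda>w. B (A w)" "range f" "f 0"])
      show "linear (\<lambda>w. A (B w))" "linear (\<lambda>w. B (A w))"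
        using linear_compose[OF B(1) A(1)] linear_compose[OF A(1) B(1)] by (simp_all add: comp_def)
      show "A (B w) + (A c + b) = B (A w) + (B b + c)" if "w \<in> range f" for w
      proof -
        obtain z where "w = f z" using \<open>w \<in> range f\<close> by blast
        moreover have "f (z + e1 + e2) = f (z + e2 + e1)" by (simp add: add_ac)
        ultimately show ?thesis unfolding A(3) B(3) using A(1) B(1) by (simp add: linear_add add_ac)
      qed
    qed (use open_map[OF open_UNIV] in auto)
    then show ?thesis using A(1) B(1) by (simp add: linear_add add_ac)
  qed
  consider v where "v \<noteq> 0" "A v = v" "B v = v" | p where "A p + b = p" "B p + c = p"
    using commuting_affine_maps[OF A(1) B(1) comm] by blast
  then show ?thesis
  proof cases
    case 1
    show ?thesis
    proof (rule covering_if_common_fixed_vector[OF 1(1)])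
      fix \<gamma> assume \<gamma>: "torus_exp \<gamma> = torus_exp 0"
      have "\<exists>A b. linear A \<and> inj A \<and> A v = v \<and> (\<forall>z. f (z + \<gamma>) = A (f z) + b)"
      proof (rule period_generated[OF \<gamma>])
        fix \<gamma> \<delta>
        assume "\<exists>A b. linear A \<and> inj A \<and> A v = v \<and> (\<forall>z. f (z + \<gamma>) = A (f z) + b)"
          "\<exists>A b. linear A \<and> inj A \<and> A v = v \<and> (\<forall>z. f (z + \<delta>) = A (f z) + b)"
        then obtain C d C' d' where C: "linear C" "inj C" "C v = v" "\<And>z. f (z + \<gamma>) = C (f z) + d"
          and C': "linear C'" "inj C'" "C' v = v" "\<And>z. f (z + \<delta>) = C' (f z) + d'"
          by blast
        obtain R where R: "linear R" "\<And>x. R (C' x) = x" "\<And>x. C' (R x) = x"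
          using linear_injective_isomorphism[OF C'(1,2)] by blast
        have "f (z + (\<gamma> - \<delta>)) = C (R (f z)) + (d - C (R d'))" for z
        proof -
          have "C' (f (z - \<delta>)) = f z - d'" using C'(4)[of "z - \<delta>"] by simp
          then have "f (z - \<delta>) = R (f z) - R d'" using R by (metis linear_diff)
          moreover have "f (z + (\<gamma> - \<delta>)) = C (f (z - \<delta>)) + d"
            using C(4)[of "z - \<delta>"] by (simp add: algebra_simps)
          ultimately show ?thesis using C(1) by (simp add: linear_diff)
        qed
        moreover have "linear (C \<circ> R)" "inj (C \<circ> R)" "(C \<circ> R) v = v"
          using linear_compose[OF R(1) C(1)] inj_compose[OF C(2)] R C(3) C'(3)
          by (metis comp_apply inj_def)+
        ultimately show "\<exists>A b. linear A \<and> inj A \<and> A v = v \<and> (\<forall>z. f (z + (\<gamma> - \<delta>)) = A (f z) + b)"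
          by (intro exI[of _ "C \<circ> R"] exI[of _ "d - C (R d')"]) simp
      qed (use A B 1 in \<open>unfold e1_def e2_def, blast+\<close>)
      then show "\<exists>A b. linear A \<and> A v = v \<and> (\<forall>z. f (z + \<gamma>) = A (f z) + b)" by blast
    qed
  next
    case 2
    define g where "g z = f z - p" for z
    interpret g: plane_immersion g
    proof
      show "continuous_on UNIV g" unfolding g_def by (intro continuous_intros cont)
      show "\<exists>N. open N \<and> z \<in> N \<and> inj_on g N" for z using loc_inj[of z] by (simp add: inj_on_def g_def)
    qed
    have "covering_space UNIV g (range g)"
    proof (rule g.covering_if_linear_holonomy)
      fix \<gamma> assume \<gamma>: "torus_exp \<gamma> = torus_exp 0"
      show "\<exists>A. linear A \<and> inj A \<and> (\<forall>z. g (z + \<gamma>) = A (g z))"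
      proof (rule period_generated[OF \<gamma>])
        fix \<gamma> \<delta>
        assume "\<exists>A. linear A \<and> inj A \<and> (\<forall>z. g (z + \<gamma>) = A (g z))"
          "\<exists>A. linear A \<and> inj A \<and> (\<forall>z. g (z + \<delta>) = A (g z))"
        then obtain C C' where C: "linear C" "inj C" "\<And>z. g (z + \<gamma>) = C (g z)"
          and C': "linear C'" "inj C'" "\<And>z. g (z + \<delta>) = C' (g z)"
          by blast
        obtain R where R: "linear R" "\<And>x. R (C' x) = x" "\<And>x. C' (R x) = x"
          using linear_injective_isomorphism[OF C'(1,2)] by blast
        have "g (z + (\<gamma> - \<delta>)) = (C \<circ> R) (g z)" for z
        proof -
          have "g (z - \<delta>) = R (g z)" using C'(3)[of "z - \<delta>"] R(2) by simp
          then show ?thesis using C(3)[of "z - \<delta>"] by (simp add: algebra_simps)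
        qed
        moreover have "linear (C \<circ> R)" "inj (C \<circ> R)"
          using linear_compose[OF R(1) C(1)] inj_compose[OF C(2)] R by (metis inj_def)+
        ultimately show "\<exists>A. linear A \<and> inj A \<and> (\<forall>z. g (z + (\<gamma> - \<delta>)) = A (g z))" by blast
      next
        have "g (z + e1) = A (g z)" for z
        proof -
          have "g (z + e1) = A (f z) + b - (A p + b)" using A(3) 2(1) by (simp add: g_def)
          then show ?thesis by (simp add: g_def linear_diff[OF A(1)])
        qed
        moreover have "g (z + e2) = B (g z)" for z
        proof -
          have "g (z + e2) = B (f z) + c - (B p + c)" using B(3) 2(2) by (simp add: g_def)
          then show ?thesis by (simp add: g_def linear_diff[OF B(1)])
        qed
        ultimately show "\<exists>A. linear A \<and> inj A \<and> (\<forall>z. g (z + of_real (2 * pi)) = A (g z))"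
          "\<exists>A. linear A \<and> inj A \<and> (\<forall>z. g (z + \<i> * of_real (2 * pi)) = A (g z))"
          using A B unfolding e1_def e2_def by blast+
      qed
    qed
    moreover have "homeomorphism (range g) (range f) (\<lambda>w. w + p) (\<lambda>w. w - p)"
      by (rule homeomorphismI) (auto simp: g_def intro!: continuous_intros)
    ultimately show ?thesis
      by (rule covering_space_homeomorphic_transfer[OF _ homeomorphism_ident]) (simp add: g_def)
  qed
qed

end

definition plane_to_complex :: "real ^ 2 \<Rightarrow> complex" where
  "plane_to_complex v = Complex (v $ 1) (v $ 2)"

definition complex_to_plane :: "complex \<Rightarrow> real ^ 2" where
  "complex_to_plane z = vector [Re z, Im z]"

lemma complex_to_plane_inverse [simp]:
  "plane_to_complex (complex_to_plane z) = z" "complex_to_plane (plane_to_complex v) = v"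
  by (simp_all add: plane_to_complex_def complex_to_plane_def vec_eq_iff forall_2)

lemma linear_plane_to_complex: "linear plane_to_complex"
  by (rule linearI) (simp_all add: plane_to_complex_def complex_eq_iff)

lemma linear_complex_to_plane: "linear complex_to_plane"
  by (rule linearI) (simp_all add: complex_to_plane_def vec_eq_iff forall_2)

lemma Aff2_complex:
  assumes "g \<in> Aff2"
  obtains A b where "linear A" "inj A" "\<And>v. plane_to_complex (g v) = A (plane_to_complex v) + b"
proof -
  obtain L b where L: "invertible L" "g = (\<lambda>v. L *v v + b)" using assms by (auto simp: Aff2_def)
  let ?A = "plane_to_complex \<circ> ((\<lambda>v. L *v v) \<circ> complex_to_plane)"
  have "linear ?A"
    by (intro linear_compose linear_plane_to_complex linear_complex_to_plane matrix_vector_mul_linear)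
  moreover have "inj ?A"
  proof (intro inj_compose)
    show "inj (\<lambda>v. L *v v)" using L(1) by (metis invertible_left_inverse matrix_left_invertible_injective)
  qed (metis complex_to_plane_inverse injI)+
  moreover have "plane_to_complex (g v) = ?A (plane_to_complex v) + plane_to_complex b" for v
    by (simp add: L linear_add[OF linear_plane_to_complex])
  ultimately show thesis by (rule that)
qed

theorem proposition5p8:
  fixes M :: "'a::topological_space set" and \<A> :: "'a chart set"
    and Mt :: "'b::topological_space set" and p :: "'b \<Rightarrow> 'a"
    and D :: "'b \<Rightarrow> real ^ 2"
  assumes "flat_affine_two_torus M \<A>"
    and "universal_covering Mt p M"
    and "development_map Mt (inherited_structure Mt p \<A>) D"
  shows "covering_space Mt D (D ` Mt)"
proof -
  have flat: "flat_affine_structure M \<A>" and cov: "covering_space Mt p M" and sc: "simply_connected Mt"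
    using assms by (auto simp: flat_affine_two_torus_def universal_covering_def)
  obtain h h' where h: "homeomorphism M torus h h'"
    using assms(1) by (auto simp: flat_affine_two_torus_def diffeomorphic_def)
  have "covering_space Mt (\<lambda>x. h (p x)) torus"
    by (rule covering_space_homeomorphic_transfer[OF cov homeomorphism_ident h]) simp
  then obtain u k where u: "homeomorphism UNIV Mt u k" and hpu: "\<And>z. h (p (u z)) = torus_exp z"
    by (rule torus_covering_parametrisation[OF _ sc]) (rule that)
  have u_cont: "continuous_on UNIV u" and u_range: "range u = Mt"
    using u by (auto simp: homeomorphism_def)
  have pM: "p x \<in> M" if "x \<in> Mt" for x using covering_space_imp_surjective[OF cov] that by blast
  define f where "f z = plane_to_complex (D (u z))" for z
  have local: "\<exists>N. open N \<and> z \<in> N \<and> inj_on f N \<and> continuous_on N f" for z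
  proof -
    have "u z \<in> Mt" using u_range by blast
    then obtain N where N: "openin (top_of_set Mt) N" "u z \<in> N" "inj_on D N" "continuous_on N D"
      by (rule development_map_unramified[OF flat cov assms(3)]) (rule that)
    have "openin (top_of_set UNIV) (UNIV \<inter> u -` N)"
      by (rule continuous_openin_preimage[OF u_cont _ N(1)]) (use u_range in auto)
    then have "open (u -` N)" by simp
    moreover have "inj_on f (u -` N)"
    proof (rule inj_onI)
      fix x y assume xy: "x \<in> u -` N" "y \<in> u -` N" "f x = f y"
      then have "D (u x) = D (u y)" unfolding f_def by (metis complex_to_plane_inverse(2))
      then have "u x = u y" using N(3) xy by (simp add: inj_on_def)
      then show "x = y" using homeomorphism_apply1[OF u] by (metis UNIV_I)
    qed
    moreover have "continuous_on (u -` N) f" unfolding f_def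
      by (rule continuous_on_compose2[OF linear_continuous_on[OF linear_plane_to_complex[unfolded linear_conv_bounded_linear], of UNIV]],
          rule continuous_on_compose2[OF N(4) continuous_on_subset[OF u_cont]]) auto
    ultimately show ?thesis using N(2) by (intro exI[of _ "u -` N"]) simp
  qed
  interpret plane_immersion f
  proof
    show "continuous_on UNIV f" by (rule continuous_on_openin_cover) (use local in simp, blast)
  qed (use local in blast)
  have "covering_space UNIV f (range f)"
  proof (rule covering_if_affine_holonomy, rule holonomy_global)
    fix \<gamma> z :: complex assume \<gamma>: "torus_exp \<gamma> = torus_exp 0"
    have "p (u (z + \<gamma>)) = p (u z)" for z
    proof -
      have "torus_exp (z + \<gamma>) = torus_exp z" by (simp add: torus_exp_add \<gamma>)
      then have "h (p (u (z + \<gamma>))) = h (p (u z))" by (simp add: hpu)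
      then show ?thesis using homeomorphism_apply1[OF h pM] u_range by (metis rangeI)
    qed
    then obtain g N where g: "g \<in> Aff2" "open N" "z \<in> N" "\<forall>y\<in>N. D (u (y + \<gamma>)) = g (D (u y))"
      using development_map_holonomy_local[OF flat cov assms(3) u_cont, of \<gamma> z] u_range by blast
    obtain A b where "linear A" "inj A" "\<And>v. plane_to_complex (g v) = A (plane_to_complex v) + b"
      by (rule Aff2_complex[OF g(1)]) (rule that)
    then show "\<exists>A b N. linear A \<and> inj A \<and> open N \<and> z \<in> N \<and> (\<forall>y\<in>N. f (y + \<gamma>) = A (f y) + b)"
      using g unfolding f_def by (intro exI[of _ A] exI[of _ b] exI[of _ N]) simp
  qed
  moreover have "homeomorphism (range f) (D ` Mt) complex_to_plane plane_to_complex"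
  proof (rule homeomorphismI)
    show "continuous_on (range f) complex_to_plane" "continuous_on (D ` Mt) plane_to_complex"
      using linear_complex_to_plane linear_plane_to_complex
      by (auto intro!: linear_continuous_on simp: linear_conv_bounded_linear)
  qed (use u_range in \<open>auto simp: f_def\<close>)
  ultimately show ?thesis
    by (rule covering_space_homeomorphic_transfer[OF _ homeomorphism_symD[OF u]])
       (simp add: f_def homeomorphism_apply2[OF u])
qed

end
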